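(* Let $k$ be a field. Let $Y$ be the oriented graph with vertices $[p]$, $p\in\mathbb Z_{\ge 0}$, and edges $\varepsilon_p^i:[p-1]\to[p]$ ($p>0$, $0\le i\le p$), $\eta_q^j:[q+1]\to[q]$ ($q\ge0$, $0\le j\le q$) and $t_q:[q]\to[q]$ ($q\ge 0$). Let $S$ be the set of relations (for all indices for which the left-hand side is defined) $$f_{q+1,q}:\ \varepsilon_{q+1}^i\varepsilon_q^{j-1}=\varepsilon_{q+1}^j\varepsilon_q^i\quad (j>i),$$ $$g_{q,q+1}:\ \eta_q^j\eta_{q+1}^i=\eta_q^i\eta_{q+1}^{j+1}\quad (j\ge i),$$ $$h_{q-1,q}:\ \eta_{q-1}^j\varepsilon_q^i=\begin{cases}\varepsilon_{q-1}^i\eta_{q-2}^{j-1}, & j>i,\\ 1_{q-1}, & i=j \text{ or } i=j+1,\\ \varepsilon_{q-1}^{i-1}\eta_{q-2}^j, & i>j+1,\end{cases}$$ $$\rho_1:\ t_q\varepsilon_q^i=\varepsilon_q^{i-1}t_{q-1}\quad(i=1,\dots,q),$$ $$\rho_2:\ t_q\eta_q^i=\eta_q^{i-1}t_{q+1}\quad(i=1,\dots,q),$$ $$\rho_3:\ t_q^{q+1}=1_q,$$ where $1_q$ is the identity of $[q]$, so that $\Lambda=C(Y|S)$ is the cyclic category. Let $S^C=S\cup\{\rho_4,\rho_5\}$, where $$\rho_4:\ t_q\varepsilon_q^0=\varepsilon_q^q,\qquad \rho_5:\ t_q\eta_q^0=\eta_q^qt_{q+1}^2 .$$ Then: (1)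 With respect to the order $\succ_2$ on $C(Y)$ (defined in the context), $S^C$ is a Gröbner–Shirshov basis for the cyclic category partial algebra $kC(Y|S)$; that is, $S^C$ is a Gröbner–Shirshov basis in $kC(Y)$ and $Id(S^C)=Id(S)$ (each relation $u=v$ being regarded as the polynomial $u-v\in kC(Y)$). (2) Every morphism $\mu:[q]\to[p]$ in the cyclic category $\Lambda=C(Y|S)$ can be uniquely represented as $$\varepsilon_p^{i_1}\cdots\varepsilon_{p-m+1}^{i_m}\,\eta_{q-n}^{j_1}\cdots\eta_{q-1}^{j_n}\,t_q^k,$$ where $p\ge i_1>\cdots>i_m\ge 0$, $0\le j_1<\cdots<j_n<q$, $0\le k\le q$ and $q-n+m=p$.
   Context: $C(Y)$ is the free category on the graph $Y$; we also write $C(Y)$ for its set of morphisms, which are the paths ("words") in $Y$ including the empty paths $1_v$. Words are composed right to left: $uv$ means first $v$, then $u$. Products are written only when defined. $kC(Y)$, the free category partial algebra, consists of finite $k$-linear combinations of words with common domain and common codomain; multiplication extends composition linearly. $C(Y|S)$ is the quotient of $C(Y)$ by the congruence generated by $S$. For a set $T\subset kC(Y)$, $Id(T)$ is the ideal generated by $T$: the set of finite linear combinations, with common domain and codomain, of products $asb$, $a,b\in C(Y)$, $s\in T$; $kC(Y|S)=kC(Y)/Id(S)$. The index ranges: in $f_{q+1,q}$, $q\ge1$ and $0\le i<j\le q+1$; in $g_{q,q+1}$, $q\ge0$ and $0\le i\le j\le q$; in $h_{q-1,q}$, $q\ge1$, $0\le j\le q-1$, $0\le i\le q$; in $\rho_1$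 and $\rho_4$, $q\ge1$; in $\rho_2,\rho_3,\rho_5$, $q\ge0$. In (2), $m,n\ge0$. The order $\succ_2$ on $C(Y)$: (1) For words in the $t$'s (each of the form $t_p^i$, $i\ge0$, with $t_p^0=1_{[p]}$ the empty word at $[p]$): $t_p^i>t_q^j$ iff $i>j$, or $i=j$ and $p>q$. (2) $\eta_p^i>\eta_q^j$ iff $p>q$, or $p=q$ and $i<j$. (3) For a word $u=w_0\eta_{p_1}^{i_1}w_1\eta_{p_2}^{i_2}\cdots w_{n-1}\eta_{p_n}^{i_n}w_n$ in the $t$'s and $\eta$'s ($n\ge0$, each $w_i$ a possibly empty word in the $t$'s) put $wt(u)=(n,w_0,w_1,\dots,w_n,\eta_{p_n}^{i_n},\eta_{p_{n-1}}^{i_{n-1}},\dots,\eta_{p_1}^{i_1})$; two such words are compared by comparing weights lexicographically. (4) $\varepsilon_p^i>\varepsilon_q^j$ iff $p>q$, or $p=q$ and $i<j$. (5) Every $u\in C(Y)$ is uniquely $u=v_0\varepsilon_{p_1}^{i_1}v_1\varepsilon_{p_2}^{i_2}\cdots\varepsilon_{p_n}^{i_n}v_n$, $n\ge0$, with each $v_j$ a (possibly empty) word in the $t$'s and $\eta$'s; put $wt(u)=(n,v_0,v_1,\dots,v_n,\varepsilon_{p_1}^{i_1},\dots,\varepsilon_{p_n}^{i_n})$. Then $u\succ_2v$ iff $wt(u)>wt(v)$ lexicographically. This is a monomial order, i.e. a well ordering on $C(Y)$ with $u>v\Rightarrow uw>vw,\ wu>wv$ whenever the products are defined. For nonzero $f\in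 kC(Y)$, $\bar f$ is the largest word occurring in $f$ with nonzero coefficient; $f$ is monic if that coefficient is $1$. For a set $T$ of monic polynomials, a $T$-word is a defined product $asb$ with $a,b\in C(Y)$, $s\in T$. Compositions of monic $f,g$: if $w=\bar f=a\bar gb$ ($a,b\in C(Y)$), then $(f,g)_w=f-agb$; if $w=\bar fb=a\bar g$ ($a,b\in C(Y)$), then $(f,g)_w=fb-ag$. $T$ is a Gröbner–Shirshov basis in $kC(Y)$ if every composition $(f,g)_w$ with $f,g\in T$ is trivial modulo $(T,w)$, i.e. $(f,g)_w=\sum\alpha_ia_is_ib_i$ (finite sum) with $\alpha_i\in k$, $a_is_ib_i$ $T$-words ($s_i\in T$) and $a_i\bar s_ib_i<w$. *)

theory Defs
  imports "Graph_Theory.Arc_Walk" "HOL-Library.Poly_Mapping"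
begin

section \<open>The free category on a graph\<close>

text \<open>
  A word is a triple (codomain, letters, domain).  The letters are listed as they are written
  on paper, i.e. the rightmost one is travelled first; hence the list of letters is the reversal
  of the arc walk from the domain to the codomain.  The empty path at v is (v, [], v).
\<close>

type_synonym ('v, 'e) word = "'v \<times> 'e list \<times> 'v"

definition word_cod :: "('v, 'e) word \<Rightarrow> 'v" where
  "word_cod w = fst w"

definition word_dom :: "('v, 'e) word \<Rightarrow> 'v" where
  "word_dom w = snd (snd w)"

definition words_from_to :: "('v, 'e) pre_digraph \<Rightarrow> 'v \<Rightarrow> 'v \<Rightarrow> ('v, 'e) word set" where
  "words_from_to G u v = {(v, es, u) | es. pre_digraph.awalk G u (rev es) v}"

definition words :: "('v, 'e) pre_digraph \<Rightarrow> ('v, 'e) word set" where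
  "words G = (\<Union>u\<in>verts G. \<Union>v\<in>verts G. words_from_to G u v)"

definition composable :: "('v, 'e) word \<Rightarrow> ('v, 'e) word \<Rightarrow> bool" where
  "composable x y \<longleftrightarrow> word_dom x = word_cod y"

text \<open>Only meaningful for composable words.\<close>

definition word_comp :: "('v, 'e) word \<Rightarrow> ('v, 'e) word \<Rightarrow> ('v, 'e) word" (infixr \<open>\<cdot>\<close> 75) where
  "x \<cdot> y = (word_cod x, fst (snd x) @ fst (snd y), word_dom y)"

text \<open>The congruence on the free category generated by a set of pairs of parallel words; the
  morphisms from u to v of the quotient category are the elements of
  \<open>words_from_to G u v // congruence G R\<close>.\<close>

inductive_set congruence ::
  "('v, 'e) pre_digraph \<Rightarrow> (('v, 'e) word \<times> ('v, 'e) word) set \<Rightarrow>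
   (('v, 'e) word \<times> ('v, 'e) word) set"
  for G :: "('v, 'e) pre_digraph" and R :: "(('v, 'e) word \<times> ('v, 'e) word) set" where
  base: "(x, y) \<in> R \<Longrightarrow> (x, y) \<in> congruence G R"
| refl: "x \<in> words G \<Longrightarrow> (x, x) \<in> congruence G R"
| sym: "(x, y) \<in> congruence G R \<Longrightarrow> (y, x) \<in> congruence G R"
| trans: "(x, y) \<in> congruence G R \<Longrightarrow> (y, z) \<in> congruence G R \<Longrightarrow> (x, z) \<in> congruence G R"
| comp: "(x, x') \<in> congruence G R \<Longrightarrow> (y, y') \<in> congruence G R \<Longrightarrow> composable x y \<Longrightarrow>
    (x \<cdot> y, x' \<cdot> y') \<in> congruence G R"

definition quotient_hom ::
  "('v, 'e) pre_digraph \<Rightarrow> (('v, 'e) word \<times> ('v, 'e) word) set \<Rightarrow> 'v \<Rightarrow> 'v \<Rightarrow>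
   ('v, 'e) word set set" where
  "quotient_hom G R u v = words_from_to G u v // congruence G R"


section \<open>The free category partial algebra\<close>

text \<open>Polynomials are finitely supported functions on words; \<open>polys_from_to G u v\<close> consists of
  the linear combinations of words with domain u and codomain v.  The zero polynomials of the
  different hom-spaces are identified.\<close>

definition polys_from_to ::
  "('v, 'e) pre_digraph \<Rightarrow> 'v \<Rightarrow> 'v \<Rightarrow> (('v, 'e) word \<Rightarrow>\<^sub>0 'k::field) set" where
  "polys_from_to G u v = {f. Poly_Mapping.keys f \<subseteq> words_from_to G u v}"

definition polys :: "('v, 'e) pre_digraph \<Rightarrow> (('v, 'e) word \<Rightarrow>\<^sub>0 'k::field) set" where
  "polys G = (\<Union>u\<in>verts G. \<Union>v\<in>verts G. polys_from_to G u v)"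

definition poly_scale :: "'k::field \<Rightarrow> ('a \<Rightarrow>\<^sub>0 'k) \<Rightarrow> ('a \<Rightarrow>\<^sub>0 'k)" where
  "poly_scale c f = Poly_Mapping.map ((*) c) f"

lemma lookup_poly_scale [simp]:
  "Poly_Mapping.lookup (poly_scale c f) x = c * Poly_Mapping.lookup f x"
  by (simp add: poly_scale_def Poly_Mapping.map.rep_eq when_def)

interpretation polys: vector_space "poly_scale :: 'k::field \<Rightarrow> ('a \<Rightarrow>\<^sub>0 'k) \<Rightarrow> ('a \<Rightarrow>\<^sub>0 'k)"
  by unfold_locales (auto intro!: poly_mapping_eqI simp: lookup_add algebra_simps)

definition of_word :: "('v, 'e) word \<Rightarrow> (('v, 'e) word \<Rightarrow>\<^sub>0 'k::field)" where
  "of_word x = Poly_Mapping.single x 1"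

definition poly_mult ::
  "(('v, 'e) word \<Rightarrow>\<^sub>0 'k::field) \<Rightarrow> (('v, 'e) word \<Rightarrow>\<^sub>0 'k) \<Rightarrow> (('v, 'e) word \<Rightarrow>\<^sub>0 'k)"
  (infixl \<open>\<odot>\<close> 70) where
  "f \<odot> g = (\<Sum>x\<in>Poly_Mapping.keys f. \<Sum>y\<in>Poly_Mapping.keys g.
     Poly_Mapping.single (x \<cdot> y) (Poly_Mapping.lookup f x * Poly_Mapping.lookup g y))"

text \<open>\<open>T_words G T u v\<close> consists of the triples (a, s, b), s in T, for which the product asb is
  defined and has domain u and codomain v.\<close>

definition T_words ::
  "('v, 'e) pre_digraph \<Rightarrow> (('v, 'e) word \<Rightarrow>\<^sub>0 'k::field) set \<Rightarrow> 'v \<Rightarrow> 'v \<Rightarrow>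
   (('v, 'e) word \<times> (('v, 'e) word \<Rightarrow>\<^sub>0 'k) \<times> ('v, 'e) word) set" where
  "T_words G T u v = {(a, s, b). s \<in> T \<and>
     (\<exists>x y. a \<in> words_from_to G y v \<and> s \<in> polys_from_to G x y \<and> b \<in> words_from_to G u x)}"

definition T_word_poly ::
  "('v, 'e) word \<times> (('v, 'e) word \<Rightarrow>\<^sub>0 'k::field) \<times> ('v, 'e) word \<Rightarrow> (('v, 'e) word \<Rightarrow>\<^sub>0 'k)" where
  "T_word_poly = (\<lambda>(a, s, b). of_word a \<odot> s \<odot> of_word b)"

definition poly_ideal ::
  "('v, 'e) pre_digraph \<Rightarrow> (('v, 'e) word \<Rightarrow>\<^sub>0 'k::field) set \<Rightarrow> (('v, 'e) word \<Rightarrow>\<^sub>0 'k) set" where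
  "poly_ideal G T = (\<Union>u\<in>verts G. \<Union>v\<in>verts G. polys.span (T_word_poly ` T_words G T u v))"


section \<open>Groebner-Shirshov bases\<close>

text \<open>An order is given as the set r of all pairs (smaller word, larger word).\<close>

definition lead_word ::
  "(('v, 'e) word \<times> ('v, 'e) word) set \<Rightarrow> (('v, 'e) word \<Rightarrow>\<^sub>0 'k::field) \<Rightarrow> ('v, 'e) word" where
  "lead_word r f = (THE w. w \<in> Poly_Mapping.keys f \<and>
     (\<forall>x\<in>Poly_Mapping.keys f. x \<noteq> w \<longrightarrow> (x, w) \<in> r))"

definition monic ::
  "(('v, 'e) word \<times> ('v, 'e) word) set \<Rightarrow> (('v, 'e) word \<Rightarrow>\<^sub>0 'k::field) \<Rightarrow> bool" where
  "monic r f \<longleftrightarrow> f \<noteq> 0 \<and> Poly_Mapping.lookup f (lead_word r f) = 1"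

definition trivial_modulo ::
  "('v, 'e) pre_digraph \<Rightarrow> (('v, 'e) word \<times> ('v, 'e) word) set \<Rightarrow>
   (('v, 'e) word \<Rightarrow>\<^sub>0 'k::field) set \<Rightarrow> ('v, 'e) word \<Rightarrow> (('v, 'e) word \<Rightarrow>\<^sub>0 'k) \<Rightarrow> bool" where
  "trivial_modulo G r T w h \<longleftrightarrow>
     h \<in> polys.span (T_word_poly `
       {(a, s, b) \<in> T_words G T (word_dom w) (word_cod w). (a \<cdot> lead_word r s \<cdot> b, w) \<in> r})"

definition gs_basis ::
  "('v, 'e) pre_digraph \<Rightarrow> (('v, 'e) word \<times> ('v, 'e) word) set \<Rightarrow>
   (('v, 'e) word \<Rightarrow>\<^sub>0 'k::field) set \<Rightarrow> bool" where
  "gs_basis G r T \<longleftrightarrow>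
     (\<forall>f\<in>T. f \<in> polys G \<and> monic r f) \<and>
     (\<forall>f\<in>T. \<forall>g\<in>T. \<forall>a\<in>words G. \<forall>b\<in>words G.
        composable a (lead_word r g) \<and> composable (lead_word r g) b \<and>
        lead_word r f = a \<cdot> lead_word r g \<cdot> b \<longrightarrow>
        trivial_modulo G r T (lead_word r f) (f - of_word a \<odot> g \<odot> of_word b)) \<and>
     (\<forall>f\<in>T. \<forall>g\<in>T. \<forall>a\<in>words G. \<forall>b\<in>words G.
        composable (lead_word r f) b \<and> composable a (lead_word r g) \<and>
        lead_word r f \<cdot> b = a \<cdot> lead_word r g \<longrightarrow>
        trivial_modulo G r T (lead_word r f \<cdot> b) (f \<odot> of_word b - of_word a \<odot> g))"


section \<open>The graph Y and the relations of the cyclic category\<close>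

text \<open>\<open>Eps p i\<close>, \<open>Eta q j\<close>, \<open>Tau q\<close> are \<open>\<epsilon>\<close>, \<open>\<eta>\<close>, \<open>t\<close> with the lower index first.\<close>

datatype edge = Eps nat nat | Eta nat nat | Tau nat

fun edge_tail :: "edge \<Rightarrow> nat" where
  "edge_tail (Eps p i) = p - 1"
| "edge_tail (Eta q j) = q + 1"
| "edge_tail (Tau q) = q"

fun edge_head :: "edge \<Rightarrow> nat" where
  "edge_head (Eps p i) = p"
| "edge_head (Eta q j) = q"
| "edge_head (Tau q) = q"

definition Y :: "(nat, edge) pre_digraph" where
  "Y = \<lparr> verts = UNIV,
         arcs = {Eps p i | p i. p > 0 \<and> i \<le> p} \<union> {Eta q j | q j. j \<le> q} \<union> range Tau,
         tail = edge_tail, head = edge_head \<rparr>"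

type_synonym Y_word = "(nat, edge) word"

definition rel_f :: "(Y_word \<times> Y_word) set" where
  "rel_f = {((q + 1, [Eps (q + 1) i, Eps q (j - 1)], q - 1),
             (q + 1, [Eps (q + 1) j, Eps q i], q - 1)) | q i j.
             q \<ge> 1 \<and> i < j \<and> j \<le> q + 1}"

definition rel_g :: "(Y_word \<times> Y_word) set" where
  "rel_g = {((q, [Eta q j, Eta (q + 1) i], q + 2),
             (q, [Eta q i, Eta (q + 1) (j + 1)], q + 2)) | q i j.
             i \<le> j \<and> j \<le> q}"

definition rel_h :: "(Y_word \<times> Y_word) set" where
  "rel_h = {((q - 1, [Eta (q - 1) j, Eps q i], q - 1),
             (q - 1,
              if j > i then [Eps (q - 1) i, Eta (q - 2) (j - 1)]
              else if i = j \<or> i = j + 1 then []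
              else [Eps (q - 1) (i - 1), Eta (q - 2) j],
              q - 1)) | q i j.
             q \<ge> 1 \<and> j \<le> q - 1 \<and> i \<le> q}"

definition rel_rho1 :: "(Y_word \<times> Y_word) set" where
  "rel_rho1 = {((q, [Tau q, Eps q i], q - 1), (q, [Eps q (i - 1), Tau (q - 1)], q - 1)) | q i.
                q \<ge> 1 \<and> 1 \<le> i \<and> i \<le> q}"

definition rel_rho2 :: "(Y_word \<times> Y_word) set" where
  "rel_rho2 = {((q, [Tau q, Eta q i], q + 1), (q, [Eta q (i - 1), Tau (q + 1)], q + 1)) | q i.
                1 \<le> i \<and> i \<le> q}"

definition rel_rho3 :: "(Y_word \<times> Y_word) set" where
  "rel_rho3 = {((q, replicate (q + 1) (Tau q), q), (q, [], q)) | q. True}"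

definition rel_rho4 :: "(Y_word \<times> Y_word) set" where
  "rel_rho4 = {((q, [Tau q, Eps q 0], q - 1), (q, [Eps q q], q - 1)) | q. q \<ge> 1}"

definition rel_rho5 :: "(Y_word \<times> Y_word) set" where
  "rel_rho5 = {((q, [Tau q, Eta q 0], q + 1),
                (q, [Eta q q, Tau (q + 1), Tau (q + 1)], q + 1)) | q. True}"

definition S :: "(Y_word \<times> Y_word) set" where
  "S = rel_f \<union> rel_g \<union> rel_h \<union> rel_rho1 \<union> rel_rho2 \<union> rel_rho3"

definition S\<^sub>C :: "(Y_word \<times> Y_word) set" where
  "S\<^sub>C = S \<union> rel_rho4 \<union> rel_rho5"

definition rel_polys ::
  "(('v, 'e) word \<times> ('v, 'e) word) set \<Rightarrow> (('v, 'e) word \<Rightarrow>\<^sub>0 'k::field) set" where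
  "rel_polys R = {of_word u - of_word v | u v. (u, v) \<in> R}"


section \<open>The order on the words in Y\<close>

fun is_eps :: "edge \<Rightarrow> bool" where
  "is_eps (Eps p i) = True"
| "is_eps (Eta q j) = False"
| "is_eps (Tau q) = False"

fun is_eta :: "edge \<Rightarrow> bool" where
  "is_eta (Eps p i) = False"
| "is_eta (Eta q j) = True"
| "is_eta (Tau q) = False"

text \<open>\<open>separators P u\<close> and \<open>blocks P u\<close> give the decomposition
  \<open>u = v\<^sub>0 e\<^sub>1 v\<^sub>1 \<dots> e\<^sub>n v\<^sub>n\<close> in which the \<open>e\<^sub>k\<close> are the letters of u satisfying P and the
  (possibly empty) words \<open>v\<^sub>k\<close>, which carry their endpoints, contain no such letter.\<close>

definition separators :: "(edge \<Rightarrow> bool) \<Rightarrow> Y_word \<Rightarrow> edge list" where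
  "separators P u = filter P (fst (snd u))"

fun block_list :: "(edge \<Rightarrow> bool) \<Rightarrow> nat \<Rightarrow> edge list \<Rightarrow> nat \<Rightarrow> Y_word list" where
  "block_list P c [] d = [(c, [], d)]"
| "block_list P c (e # es) d =
     (let bs = block_list P (edge_tail e) es d in
      if P e then (c, [], edge_head e) # bs
      else (c, e # fst (snd (hd bs)), word_dom (hd bs)) # tl bs)"

definition blocks :: "(edge \<Rightarrow> bool) \<Rightarrow> Y_word \<Rightarrow> Y_word list" where
  "blocks P u = block_list P (word_cod u) (fst (snd u)) (word_dom u)"

fun interleave :: "Y_word list \<Rightarrow> edge list \<Rightarrow> Y_word" where
  "interleave (v # vs) (e # es) = v \<cdot> (edge_head e, [e], edge_tail e) \<cdot> interleave vs es"
| "interleave (v # vs) [] = v"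
| "interleave [] es = undefined"

lemma block_list_ne [simp]: "block_list P c es d \<noteq> []"
  by (cases es) (auto simp: Let_def)

lemma interleave_blocks: "interleave (blocks P u) (separators P u) = u"
proof -
  have "interleave (block_list P c es d) (filter P es) = (c, es, d)" for c es d
  proof (induction es arbitrary: c)
    case (Cons e es)
    show ?case
    proof (cases "P e")
      case True
      then show ?thesis
        by (simp add: Let_def Cons.IH word_comp_def word_cod_def word_dom_def)
    next
      case False
      obtain b bs where b: "block_list P (edge_tail e) es d = b # bs"
        by (cases "block_list P (edge_tail e) es d") auto
      show ?thesis
        using False b Cons.IH [of "edge_tail e"]
        by (cases "filter P es") (auto simp: word_comp_def word_cod_def word_dom_def)
    qed
  qed simp
  then show ?thesis
    by (simp add: blocks_def separators_def word_cod_def word_dom_def)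
qed

text \<open>All relations below consist of pairs (smaller, larger).  For words in the \<open>t\<close>'s,
  \<open>t\<^sub>p\<close> to the power i is (p, replicate i (Tau p), p).\<close>

definition t_less :: "(Y_word \<times> Y_word) set" where
  "t_less = inv_image (less_than <*lex*> less_than) (\<lambda>u. (length (fst (snd u)), word_cod u))"

definition eta_less :: "(edge \<times> edge) set" where
  "eta_less = {(Eta q j, Eta p i) | q j p i. j \<le> q \<and> i \<le> p \<and> (p > q \<or> p = q \<and> i < j)}"

definition eps_less :: "(edge \<times> edge) set" where
  "eps_less = {(Eps q j, Eps p i) | q j p i.
     0 < q \<and> j \<le> q \<and> 0 < p \<and> i \<le> p \<and> (p > q \<or> p = q \<and> i < j)}"

text \<open>\<open>lex\<close> compares only lists of the same length, which is the case here as soon as the first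
  components of the weights agree.\<close>

definition t_eta_less :: "(Y_word \<times> Y_word) set" where
  "t_eta_less = inv_image (less_than <*lex*> lex t_less <*lex*> lex eta_less)
     (\<lambda>u. (length (separators is_eta u), blocks is_eta u, rev (separators is_eta u)))"

definition less\<^sub>2 :: "(Y_word \<times> Y_word) set" where
  "less\<^sub>2 = inv_image (less_than <*lex*> lex t_eta_less <*lex*> lex eps_less)
     (\<lambda>u. (length (separators is_eps u), blocks is_eps u, separators is_eps u))"


section \<open>Normal forms\<close>

text \<open>The index sequences are the lists is and js, so that m and n are their lengths.  The
  condition on js implies that n is at most q, so q - n does not truncate; the dimension equation
  q - n + m = p is written without subtraction.\<close>

definition normal_word :: "nat \<Rightarrow> nat \<Rightarrow> nat list \<Rightarrow> nat list \<Rightarrow> nat \<Rightarrow> Y_word" where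
  "normal_word p q is js k =
     (p,
      map (\<lambda>r. Eps (p - r) (is ! r)) [0..<length is] @
      map (\<lambda>r. Eta (q - length js + r) (js ! r)) [0..<length js] @
      replicate k (Tau q),
      q)"

definition normal_indices :: "nat \<Rightarrow> nat \<Rightarrow> nat list \<Rightarrow> nat list \<Rightarrow> nat \<Rightarrow> bool" where
  "normal_indices p q is js k \<longleftrightarrow>
     sorted_wrt (>) is \<and> (\<forall>i\<in>set is. i \<le> p) \<and>
     sorted_wrt (<) js \<and> (\<forall>j\<in>set js. j < q) \<and>
     k \<le> q \<and> q + length is = p + length js"

end

(* Every defining pair (u, v) of S^C has leading word u, so the rewriting u -> v strictly decreases
   words; an irreducible word is a word in the epsilons, followed by one in the etas, followed by a
   power of t, with monotone indices, that is, a normal word.  The words of Y act on the integers: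
   the cofaces and codegeneracies act periodically and t acts by x |-> x - 1.  Congruent words act
   in the same way up to a translation by a period, and this separates normal words: the epsilon
   indices are the values that are missed, the eta indices are the places where a value is
   repeated, and the exponent of t is the offset.  Hence each morphism has exactly one normal
   word.  No critical pair has to be inspected: both words of a composition lie below w and are
   congruent, so they reduce to the same normal word through words below w. *)

theory Submission
  imports Defs
begin

section \<open>Paths in Y\<close>

text \<open>The hard point is to show that distinct normal words are not congruent. Maps of the
  finite sets {0..q} cannot do this: every word with codomain [0] induces the constant map, whereas
  the normal words from [q] to [0] carry q + 1 different powers of t. Lifting to the integers gives
  the classical model of the cyclic category: monotone maps f with f(x + q + 1) = f(x) + p + 1,
  modulo translations by p + 1. The translations absorb rho_3, because t_q^(q+1) acts as x - (q +
  1). Only the relations in \<open>S\<close> have to be checked against the action, since rho_4 and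
  rho_5 follow from them by moving powers of t across a coface or a codegeneracy. For rewriting they
  are nevertheless indispensable: without them t_q eps_q^0 and t_q eta_q^0 with q >= 1 would be
  irreducible but not normal.\<close>

fun Y_path :: "nat \<Rightarrow> edge list \<Rightarrow> nat \<Rightarrow> bool" where
  "Y_path c [] d \<longleftrightarrow> c = d"
| "Y_path c (e # es) d \<longleftrightarrow> e \<in> arcs Y \<and> c = edge_head e \<and> Y_path (edge_tail e) es d"

lemma arcs_Y [simp]:
  "Eps p i \<in> arcs Y \<longleftrightarrow> 0 < p \<and> i \<le> p"
  "Eta q j \<in> arcs Y \<longleftrightarrow> j \<le> q"
  "Tau q \<in> arcs Y"
  by (auto simp: Y_def)

lemma Y_path_append: "Y_path c (xs @ ys) d \<longleftrightarrow> (\<exists>m. Y_path c xs m \<and> Y_path m ys d)"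
  by (induction xs arbitrary: c) auto

text \<open>Walks list their arcs from the domain, words list their letters from the codomain.
  \<open>Y_path\<close> recurses on the letters as they are written, so that later inductions can
  peel off the leftmost letter without \<open>rev\<close>.\<close>

lemma words_from_to_Y:
  "w \<in> words_from_to Y d c \<longleftrightarrow> (\<exists>es. w = (c, es, d) \<and> Y_path c es d)"
proof -
  have snoc: "pre_digraph.cas Y u (xs @ [e]) v \<longleftrightarrow>
      pre_digraph.cas Y u xs (edge_tail e) \<and> edge_head e = v" for u v xs e
    by (induction xs arbitrary: u) (auto simp: pre_digraph.cas.simps Y_def)
  have "Y_path c es d \<longleftrightarrow> set es \<subseteq> arcs Y \<and> pre_digraph.cas Y d (rev es) c" for es
    by (induction es arbitrary: c) (auto simp: snoc pre_digraph.cas.simps)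
  then show ?thesis
    by (auto simp: words_from_to_def pre_digraph.awalk_def Y_def)
qed

lemma words_Y: "w \<in> words Y \<longleftrightarrow> Y_path (word_cod w) (fst (snd w)) (word_dom w)"
proof -
  have "verts Y = UNIV"
    by (simp add: Y_def)
  then show ?thesis
    by (cases w) (auto simp: words_def words_from_to_Y word_cod_def word_dom_def)
qed

section \<open>The order on words\<close>

definition cons_word :: "edge \<Rightarrow> Y_word \<Rightarrow> Y_word" where
  "cons_word e u = (edge_head e, e # fst (snd u), word_dom u)"

definition snoc_word :: "edge \<Rightarrow> Y_word \<Rightarrow> Y_word" where
  "snoc_word e u = (word_cod u, fst (snd u) @ [e], edge_tail e)"

text \<open>Compatibility is stated for single letters from a class \<open>Q\<close>, because a
  block at one level of the order contains no separator of that level. Longer factors follow by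
  induction on their letters.\<close>

definition left_compatible :: "(edge \<Rightarrow> bool) \<Rightarrow> (Y_word \<times> Y_word) set \<Rightarrow> bool" where
  "left_compatible Q r \<longleftrightarrow> (\<forall>e x y. Q e \<longrightarrow> (x, y) \<in> r \<longrightarrow> word_cod x = edge_tail e \<longrightarrow>
     word_cod y = edge_tail e \<longrightarrow> (cons_word e x, cons_word e y) \<in> r)"

definition right_compatible :: "(edge \<Rightarrow> bool) \<Rightarrow> (Y_word \<times> Y_word) set \<Rightarrow> bool" where
  "right_compatible Q r \<longleftrightarrow> (\<forall>e x y. Q e \<longrightarrow> (x, y) \<in> r \<longrightarrow> word_dom x = edge_head e \<longrightarrow>
     word_dom y = edge_head e \<longrightarrow> (snoc_word e x, snoc_word e y) \<in> r)"

text \<open>Both levels of the order have this shape: \<open>P\<close> selects the separators,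
  \<open>r\<close> orders the blocks, \<open>s\<close> orders the separators, and \<open>g\<close>
  is the direction in which the separators are read. Each property is thus proved once and applied
  twice.\<close>

definition weight_less ::
  "(edge \<Rightarrow> bool) \<Rightarrow> (edge list \<Rightarrow> edge list) \<Rightarrow> (Y_word \<times> Y_word) set \<Rightarrow> (edge \<times> edge) set \<Rightarrow>
   (Y_word \<times> Y_word) set" where
  "weight_less P g r s = inv_image (less_than <*lex*> lex r <*lex*> lex s)
     (\<lambda>u. (length (separators P u), blocks P u, g (separators P u)))"

lemma t_eta_less_weight: "t_eta_less = weight_less is_eta rev t_less eta_less"
  by (simp add: t_eta_less_def weight_less_def)

lemma less\<^sub>2_weight: "less\<^sub>2 = weight_less is_eps (\<lambda>xs. xs) t_eta_less eps_less"
  by (simp add: less\<^sub>2_def weight_less_def)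

lemma length_block_list: "length (block_list P c es d) = Suc (length (filter P es))"
proof (induction es arbitrary: c)
  case (Cons e es)
  then show ?case
    using block_list_ne [of P "edge_tail e" es d]
    by (auto simp: Let_def length_greater_0_conv [symmetric] simp del: block_list_ne)
qed simp

lemma length_blocks: "length (blocks P u) = Suc (length (separators P u))"
  by (simp add: blocks_def separators_def length_block_list)

lemma cod_hd_block_list: "word_cod (hd (block_list P c es d)) = c"
  by (cases es) (auto simp: Let_def word_cod_def)

lemma dom_last_block_list: "word_dom (last (block_list P c es d)) = d"
proof (induction es arbitrary: c)
  case (Cons e es)
  show ?case
    using Cons.IH [of "edge_tail e"]
    by (cases "block_list P (edge_tail e) es d") (auto simp: Let_def word_dom_def)
qed (simp add: word_dom_def)

lemma blocks_cons_word:
  assumes "word_cod u = edge_tail e"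
  shows "blocks P (cons_word e u) =
    (if P e then (edge_head e, [], edge_head e) # blocks P u
     else cons_word e (hd (blocks P u)) # tl (blocks P u))"
  using assms
  by (simp add: blocks_def cons_word_def word_cod_def word_dom_def Let_def)

lemma block_list_snoc:
  "block_list P c (es @ [e]) (edge_tail e) =
    (let bs = block_list P c es (edge_head e) in
     if P e then bs @ [(edge_tail e, [], edge_tail e)]
     else butlast bs @ [snoc_word e (last bs)])"
proof (induction es arbitrary: c)
  case Nil
  show ?case by (simp add: snoc_word_def word_cod_def word_dom_def Let_def)
next
  case (Cons x es)
  obtain b bs where b: "block_list P (edge_tail x) es (edge_head e) = b # bs"
    by (cases "block_list P (edge_tail x) es (edge_head e)") auto
  show ?case
    using Cons.IH [of "edge_tail x"] b
    by (cases bs) (auto simp: Let_def snoc_word_def word_cod_def word_dom_def)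
qed

lemma blocks_snoc_word:
  assumes "word_dom u = edge_head e"
  shows "blocks P (snoc_word e u) =
    (if P e then blocks P u @ [(edge_tail e, [], edge_tail e)]
     else butlast (blocks P u) @ [snoc_word e (last (blocks P u))])"
  using assms block_list_snoc [of P "word_cod u" "fst (snd u)" e]
  by (simp add: blocks_def snoc_word_def word_cod_def word_dom_def Let_def)

lemma separators_cons_word:
  "separators P (cons_word e u) = (if P e then e # separators P u else separators P u)"
  by (simp add: separators_def cons_word_def)

lemma separators_snoc_word:
  "separators P (snoc_word e u) = (if P e then separators P u @ [e] else separators P u)"
  by (simp add: separators_def snoc_word_def)

lemma lex_snoc_iff:
  assumes "length xs = length ys"
  shows "(xs @ [a], ys @ [b]) \<in> lex r \<longleftrightarrow> (xs, ys) \<in> lex r \<or> xs = ys \<and> (a, b) \<in> r"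
  using assms by (induction xs ys rule: list_induct2) auto

text \<open>A separator in front adds the same empty block to both block lists; any other letter
  changes only the first block, which \<open>r\<close> controls. The condition on \<open>g\<close>
  says that the reading direction tolerates a common letter in front. For \<open>rev\<close> that
  letter lands at the end, which is harmless because \<open>lex\<close> relates only lists of equal
  length.\<close>

lemma left_compatible_weight_less:
  assumes r: "left_compatible (\<lambda>e. Q e \<and> \<not> P e) r"
    and g: "\<And>e xs ys. (g xs, g ys) \<in> lex s \<Longrightarrow> (g (e # xs), g (e # ys)) \<in> lex s"
  shows "left_compatible Q (weight_less P g r s)"
  unfolding left_compatible_def
proof (intro allI impI)
  fix e x y
  assume e: "Q e" and xy: "(x, y) \<in> weight_less P g r s"
    and x: "word_cod x = edge_tail e" and y: "word_cod y = edge_tail e"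
  show "(cons_word e x, cons_word e y) \<in> weight_less P g r s"
  proof (cases "P e")
    case True
    then show ?thesis
      using xy g [of "separators P x" "separators P y" e]
      by (auto simp: weight_less_def blocks_cons_word [OF x] blocks_cons_word [OF y]
          separators_cons_word)
  next
    case False
    obtain b bs where b: "blocks P x = b # bs"
      using length_blocks [of P x] by (cases "blocks P x") auto
    obtain b' bs' where b': "blocks P y = b' # bs'"
      using length_blocks [of P y] by (cases "blocks P y") auto
    have "word_cod b = edge_tail e" "word_cod b' = edge_tail e"
      using b b' cod_hd_block_list [of P "word_cod x"] cod_hd_block_list [of P "word_cod y"] x y
      by (metis blocks_def list.sel(1))+
    then have "(b, b') \<in> r \<Longrightarrow> (cons_word e b, cons_word e b') \<in> r"
      using r e False unfolding left_compatible_def by blast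
    then show ?thesis
      using xy False
      by (auto simp: weight_less_def blocks_cons_word [OF x] blocks_cons_word [OF y]
          separators_cons_word b b')
  qed
qed

lemma right_compatible_weight_less:
  assumes r: "right_compatible (\<lambda>e. Q e \<and> \<not> P e) r"
    and g: "\<And>e xs ys. (g xs, g ys) \<in> lex s \<Longrightarrow> (g (xs @ [e]), g (ys @ [e])) \<in> lex s"
  shows "right_compatible Q (weight_less P g r s)"
  unfolding right_compatible_def
proof (intro allI impI)
  fix e x y
  assume e: "Q e" and xy: "(x, y) \<in> weight_less P g r s"
    and x: "word_dom x = edge_head e" and y: "word_dom y = edge_head e"
  show "(snoc_word e x, snoc_word e y) \<in> weight_less P g r s"
  proof (cases "P e")
    case True
    then show ?thesis
      using xy g [of "separators P x" "separators P y" e]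
      by (auto simp: weight_less_def blocks_snoc_word [OF x] blocks_snoc_word [OF y]
          separators_snoc_word intro: lex_append_rightI)
  next
    case False
    have ne: "blocks P x \<noteq> []" "blocks P y \<noteq> []"
      using length_blocks [of P x] length_blocks [of P y] by auto
    obtain b bs where b: "blocks P x = bs @ [b]"
      using ne by (metis rev_exhaust)
    obtain b' bs' where b': "blocks P y = bs' @ [b']"
      using ne by (metis rev_exhaust)
    have "word_dom b = edge_head e" "word_dom b' = edge_head e"
      using b b' dom_last_block_list [of P "word_cod x" "fst (snd x)" "word_dom x"]
        dom_last_block_list [of P "word_cod y" "fst (snd y)" "word_dom y"] x y
      by (simp_all add: blocks_def)
    then have bb: "(b, b') \<in> r \<Longrightarrow> (snoc_word e b, snoc_word e b') \<in> r"
      using r e False unfolding right_compatible_def by blast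
    have len: "length bs = length (separators P x)" "length bs' = length (separators P y)"
      using length_blocks [of P x] length_blocks [of P y] b b' by auto
    \<comment> \<open>\<open>lex_snoc_iff\<close> needs lists of equal length; if the lengths
      differ, the numbers of separators have already decided the comparison.\<close>
    then show ?thesis
      using xy False bb
      by (cases "length bs = length bs'")
        (auto simp: weight_less_def blocks_snoc_word [OF x] blocks_snoc_word [OF y]
          separators_snoc_word b b' lex_snoc_iff)
  qed
qed

lemma left_compatible_less\<^sub>2: "left_compatible (\<lambda>e. True) less\<^sub>2"
proof -
  have "left_compatible (\<lambda>e. \<not> is_eps e \<and> \<not> is_eta e) t_less"
    by (auto simp: left_compatible_def t_less_def cons_word_def word_cod_def)
  then have "left_compatible (\<lambda>e. \<not> is_eps e) t_eta_less"
    unfolding t_eta_less_weight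
    by (rule left_compatible_weight_less) (auto intro: lex_append_rightI)
  then show ?thesis
    unfolding less\<^sub>2_weight
    by (intro left_compatible_weight_less) auto
qed

lemma right_compatible_less\<^sub>2: "right_compatible (\<lambda>e. True) less\<^sub>2"
proof -
  have "right_compatible (\<lambda>e. \<not> is_eps e \<and> \<not> is_eta e) t_less"
    by (auto simp: right_compatible_def t_less_def snoc_word_def word_cod_def)
  then have "right_compatible (\<lambda>e. \<not> is_eps e) t_eta_less"
    unfolding t_eta_less_weight
    by (rule right_compatible_weight_less) auto
  then show ?thesis
    unfolding less\<^sub>2_weight
    by (intro right_compatible_weight_less) (auto intro: lex_append_rightI)
qed

lemma less\<^sub>2_prepend:
  assumes "((m, u, d), (m, v, d')) \<in> less\<^sub>2" "Y_path c a m"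
  shows "((c, a @ u, d), (c, a @ v, d')) \<in> less\<^sub>2"
  using assms(2)
proof (induction a arbitrary: c)
  case (Cons e a)
  then have "((edge_tail e, a @ u, d), (edge_tail e, a @ v, d')) \<in> less\<^sub>2"
    by simp
  then show ?case
    using left_compatible_less\<^sub>2 Cons.prems
    by (force simp: left_compatible_def cons_word_def word_cod_def word_dom_def)
qed (use assms in simp)

lemma less\<^sub>2_append:
  assumes "((c, u, m), (c', v, m)) \<in> less\<^sub>2" "Y_path m b d"
  shows "((c, u @ b, d), (c', v @ b, d)) \<in> less\<^sub>2"
  using assms(2)
proof (induction b arbitrary: d rule: rev_induct)
  case (snoc e b)
  then have p: "Y_path m b (edge_head e)" "d = edge_tail e"
    by (auto simp: Y_path_append)
  then have "((c, u @ b, edge_head e), (c', v @ b, edge_head e)) \<in> less\<^sub>2"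
    using snoc.IH by simp
  then show ?case
    using right_compatible_less\<^sub>2 p
    by (force simp: right_compatible_def snoc_word_def word_cod_def word_dom_def)
qed (use assms in simp)

section \<open>Transitivity and well-foundedness of the order\<close>

lemma trans_weight_less:
  assumes "trans r" "trans s"
  shows "trans (weight_less P g r s)"
  unfolding weight_less_def using assms
  by (intro trans_inv_image trans_lex_prod trans_less_than lex_transI)

lemma wf_weight_less:
  assumes "wf r" "wf s"
  shows "wf (weight_less P g r s)"
  unfolding weight_less_def using assms
  by (intro wf_inv_image wf_lex_prod wf_less_than wf_lex)

lemma trans_less\<^sub>2: "trans less\<^sub>2"
proof -
  have "trans t_less" "trans eta_less" "trans eps_less"
    by (auto simp: t_less_def intro!: trans_inv_image trans_lex_prod)
      (auto simp: trans_def eta_less_def eps_less_def)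
  then show ?thesis
    by (simp add: less\<^sub>2_weight t_eta_less_weight trans_weight_less)
qed

lemma wf_less\<^sub>2: "wf less\<^sub>2"
proof -
  have t: "wf t_less"
    by (auto simp: t_less_def)
  \<comment> \<open>Among letters with the same lower index the smaller upper index is the larger
    letter, so the measure uses p - i. The bounds built into \<open>eta_less\<close> and
    \<open>eps_less\<close> keep this subtraction from truncating.\<close>
  define m :: "edge \<Rightarrow> nat \<times> nat" where
    "m e = (case e of Eps p i \<Rightarrow> (p, p - i) | Eta q j \<Rightarrow> (q, q - j) | Tau q \<Rightarrow> (0, 0))" for e
  have "wf (inv_image (less_than <*lex*> less_than) m)"
    by auto
  then have "wf eta_less" "wf eps_less"
    by (rule wf_subset, auto simp: eta_less_def eps_less_def m_def)+
  then show ?thesis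
    using t by (simp add: less\<^sub>2_weight t_eta_less_weight wf_weight_less)
qed

section \<open>Orientation of the relations\<close>

lemma block_list_no_separators:
  "\<forall>e\<in>set es. \<not> P e \<Longrightarrow> block_list P c es d = [(c, es, d)]"
  by (induction es arbitrary: c) (auto simp: Let_def word_dom_def)

text \<open>Each relation decreases at its own place in the weight: f at the first coface, where the
  index grows from i to j; g at the last codegeneracy, where it grows from i to j + 1, which is why
  codegeneracies are read from the right; h by losing the eta in the first block or by losing a
  coface; rho_1, rho_2, rho_4 and rho_5 by emptying the first block of t's. The words of rho_3 have
  a length depending on q, so their weights are treated apart.\<close>

lemma rel_less\<^sub>2:
  assumes "(u, v) \<in> S\<^sub>C"
  shows "(v, u) \<in> less\<^sub>2"
proof (cases "(u, v) \<in> rel_rho3")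
  case True
  then obtain q where uv: "u = (q, replicate (q + 1) (Tau q), q)" "v = (q, [], q)"
    by (auto simp: rel_rho3_def)
  have "blocks P u = [u]" "blocks P v = [v]" if "\<not> P (Tau q)" for P
    unfolding uv blocks_def using that
    by (auto simp: word_cod_def word_dom_def Let_def block_list_no_separators)
  moreover have "separators P u = []" "separators P v = []" if "\<not> P (Tau q)" for P
    using that by (auto simp: uv separators_def)
  moreover have "(v, u) \<in> t_less"
    by (simp add: uv t_less_def)
  ultimately show ?thesis
    by (simp add: less\<^sub>2_def t_eta_less_def)
next
  case False
  then show ?thesis
    using assms
    unfolding S\<^sub>C_def S_def rel_f_def rel_g_def rel_h_def rel_rho1_def rel_rho2_def rel_rho4_def
      rel_rho5_def
    by (auto simp: less\<^sub>2_def t_eta_less_def t_less_def eta_less_def eps_less_def separators_def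
        blocks_def word_cod_def word_dom_def Let_def split: if_splits)
qed

lemma rel_path:
  assumes "(u, v) \<in> S\<^sub>C"
  obtains c d l r where "u = (c, l, d)" "v = (c, r, d)" "Y_path c l d" "Y_path c r d"
proof -
  have "Y_path q (replicate n (Tau q)) q" for q n
    by (induction n) auto
  then have "\<exists>c d l r. u = (c, l, d) \<and> v = (c, r, d) \<and> Y_path c l d \<and> Y_path c r d"
    using assms
    unfolding S\<^sub>C_def S_def rel_f_def rel_g_def rel_h_def rel_rho1_def rel_rho2_def rel_rho3_def
      rel_rho4_def rel_rho5_def
    by (auto simp del: replicate_Suc replicate.simps)
  then show ?thesis
    using that by blast
qed

section \<open>Relations as polynomials\<close>

lemma word_comp_assoc: "(x \<cdot> y) \<cdot> z = x \<cdot> y \<cdot> z"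
  by (simp add: word_comp_def word_cod_def word_dom_def)

lemma word_comp_triple [simp]: "(c, xs, m) \<cdot> (n, ys, d) = (c, xs @ ys, d)"
  by (simp add: word_comp_def word_cod_def word_dom_def)

lemma of_word_mult:
  fixes g :: "('v, 'e) word \<Rightarrow>\<^sub>0 'k::field"
  assumes "finite A" "Poly_Mapping.keys g \<subseteq> A"
  shows "of_word a \<odot> g = (\<Sum>y\<in>A. Poly_Mapping.single (a \<cdot> y) (Poly_Mapping.lookup g y))"
proof -
  have "of_word a \<odot> g =
      (\<Sum>y\<in>Poly_Mapping.keys g. Poly_Mapping.single (a \<cdot> y) (Poly_Mapping.lookup g y))"
    by (simp add: poly_mult_def of_word_def)
  also have "\<dots> = (\<Sum>y\<in>A. Poly_Mapping.single (a \<cdot> y) (Poly_Mapping.lookup g y))"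
    using assms by (intro sum.mono_neutral_left) (auto simp: in_keys_iff)
  finally show ?thesis .
qed

lemma mult_of_word:
  fixes f :: "('v, 'e) word \<Rightarrow>\<^sub>0 'k::field"
  assumes "finite A" "Poly_Mapping.keys f \<subseteq> A"
  shows "f \<odot> of_word b = (\<Sum>x\<in>A. Poly_Mapping.single (x \<cdot> b) (Poly_Mapping.lookup f x))"
proof -
  have "f \<odot> of_word b =
      (\<Sum>x\<in>Poly_Mapping.keys f. Poly_Mapping.single (x \<cdot> b) (Poly_Mapping.lookup f x))"
    by (simp add: poly_mult_def of_word_def)
  also have "\<dots> = (\<Sum>x\<in>A. Poly_Mapping.single (x \<cdot> b) (Poly_Mapping.lookup f x))"
    using assms by (intro sum.mono_neutral_left) (auto simp: in_keys_iff)
  finally show ?thesis .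
qed

lemma keys_of_word_diff:
  "Poly_Mapping.keys (of_word u - of_word v :: ('v, 'e) word \<Rightarrow>\<^sub>0 'k::field) =
    (if u = v then {} else {u, v})"
  by (auto simp: of_word_def in_keys_iff lookup_minus lookup_single when_def split: if_splits)

lemma of_word_mult_diff:
  "of_word a \<odot> (of_word u - of_word v :: ('v, 'e) word \<Rightarrow>\<^sub>0 'k::field) =
    of_word (a \<cdot> u) - of_word (a \<cdot> v)"
proof (cases "u = v")
  case True
  then show ?thesis by (simp add: poly_mult_def)
next
  case False
  then show ?thesis
    by (subst of_word_mult [where A = "{u, v}"])
      (simp_all add: keys_of_word_diff, simp add: of_word_def lookup_minus lookup_single single_uminus)
qed

lemma diff_mult_of_word:
  "(of_word u - of_word v :: ('v, 'e) word \<Rightarrow>\<^sub>0 'k::field) \<odot> of_word b =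
    of_word (u \<cdot> b) - of_word (v \<cdot> b)"
proof (cases "u = v")
  case True
  then show ?thesis by (simp add: poly_mult_def)
next
  case False
  then show ?thesis
    by (subst mult_of_word [where A = "{u, v}"])
      (simp_all add: keys_of_word_diff, simp add: of_word_def lookup_minus lookup_single single_uminus)
qed

lemma lead_word_diff:
  assumes "wf r" "(v, u) \<in> r"
  shows "lead_word r (of_word u - of_word v :: ('v, 'e) word \<Rightarrow>\<^sub>0 'k::field) = u"
proof -
  have "u \<noteq> v" "(u, v) \<notin> r"
    using assms by (auto dest: wf_not_sym)
  then show ?thesis
    unfolding lead_word_def keys_of_word_diff using assms by (intro the_equality) auto
qed

section \<open>Congruent words and membership in the ideal\<close>

definition parallel :: "Y_word \<Rightarrow> Y_word \<Rightarrow> bool" where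
  "parallel x y \<longleftrightarrow> (\<exists>c d l r. x = (c, l, d) \<and> y = (c, r, d) \<and> Y_path c l d \<and> Y_path c r d)"

lemma parallel_S\<^sub>C: "(u, v) \<in> S\<^sub>C \<Longrightarrow> parallel u v"
  by (erule rel_path) (auto simp: parallel_def)

lemma congruence_parallel:
  assumes "\<And>u v. (u, v) \<in> R \<Longrightarrow> parallel u v" "(x, y) \<in> congruence Y R"
  shows "parallel x y"
  using assms(2)
proof induction
  case (refl x)
  then show ?case by (cases x) (auto simp: words_Y word_cod_def word_dom_def parallel_def)
next
  case (comp x x' y y')
  then show ?case
    by (auto simp: parallel_def composable_def word_cod_def word_dom_def Y_path_append)
qed (use assms(1) in \<open>auto simp: parallel_def\<close>)

lemma congruence_context:
  assumes "((m, l, n), (m, r, n)) \<in> congruence Y R" "Y_path c a m" "Y_path n b d"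
  shows "((c, a @ l @ b, d), (c, a @ r @ b, d)) \<in> congruence Y R"
proof -
  have b: "((n, b, d), (n, b, d)) \<in> congruence Y R" and a: "((c, a, m), (c, a, m)) \<in> congruence Y R"
    using assms by (auto intro!: congruence.refl simp: words_Y word_cod_def word_dom_def)
  have "((m, l @ b, d), (m, r @ b, d)) \<in> congruence Y R"
    using congruence.comp [OF assms(1) b]
    by (simp add: composable_def word_cod_def word_dom_def)
  from congruence.comp [OF a this] show ?thesis
    by (simp add: composable_def word_cod_def word_dom_def)
qed

lemma T_words_rel:
  assumes "((m, l, n), (m, r, n)) \<in> R" "Y_path m l n" "Y_path m r n" "Y_path c a m" "Y_path n b d"
  shows "((c, a, m), of_word (m, l, n) - of_word (m, r, n), (n, b, d)) \<in> T_words Y (rel_polys R) d c"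
proof -
  have "of_word (m, l, n) - of_word (m, r, n) \<in> polys_from_to Y n m"
    using assms by (auto simp: polys_from_to_def keys_of_word_diff words_from_to_Y)
  moreover have "of_word (m, l, n) - of_word (m, r, n) \<in> rel_polys R"
    unfolding rel_polys_def using assms(1) by blast
  ultimately show ?thesis
    using assms by (auto simp: T_words_def words_from_to_Y)
qed

lemma T_word_poly_rel:
  "T_word_poly (a, of_word u - of_word v :: ('v, 'e) word \<Rightarrow>\<^sub>0 'k::field, b) =
    of_word (a \<cdot> u \<cdot> b) - of_word (a \<cdot> v \<cdot> b)"
  by (simp add: T_word_poly_def of_word_mult_diff diff_mult_of_word word_comp_assoc)

text \<open>The zero polynomial lies in every hom-space and would not determine the endpoints of the
  relation. The condition that u and v differ keeps u in the support of s, and this ties its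
  endpoints to those of the two factors.\<close>

lemma T_words_relE:
  assumes "(a, s, b) \<in> T_words Y (rel_polys R :: (Y_word \<Rightarrow>\<^sub>0 'k::field) set) d c"
    "\<And>u v. (u, v) \<in> R \<Longrightarrow> parallel u v \<and> u \<noteq> v"
  obtains m n as l r bs where "a = (c, as, m)" "b = (n, bs, d)" "((m, l, n), (m, r, n)) \<in> R"
    "s = of_word (m, l, n) - of_word (m, r, n)" "Y_path c as m" "Y_path n bs d"
proof -
  obtain u v x y where uv: "(u, v) \<in> R" "s = of_word u - of_word v"
    and a: "a \<in> words_from_to Y y c" and b: "b \<in> words_from_to Y d x"
    and s: "s \<in> polys_from_to Y x y"
    using assms(1) by (auto simp: T_words_def rel_polys_def)
  have "u \<noteq> v" "parallel u v"
    using assms(2) uv by auto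
  moreover have "u \<in> words_from_to Y x y"
    using s \<open>u \<noteq> v\<close> by (auto simp: polys_from_to_def uv keys_of_word_diff)
  ultimately obtain l r where lr: "u = (y, l, x)" "v = (y, r, x)"
    by (auto simp: words_from_to_Y parallel_def)
  obtain as bs where "a = (c, as, y)" "b = (x, bs, d)" "Y_path c as y" "Y_path x bs d"
    using a b by (auto simp: words_from_to_Y)
  then show ?thesis
    using uv lr by (intro that [of as y x bs l r]) auto
qed

text \<open>The differences telescope: transitivity adds two of them, and a product is changed one
  factor at a time, xy - x'y' = (xy - x'y) + (x'y - x'y'). The unchanged factor then joins the
  context, so the induction must leave a and b arbitrary.\<close>

lemma congruence_span:
  assumes "\<And>u v. (u, v) \<in> R \<Longrightarrow> parallel u v" "(x, y) \<in> congruence Y R"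
    "x = (m, l, n)" "y = (m, r, n)" "Y_path c a m" "Y_path n b d"
  shows "(of_word (c, a @ l @ b, d) - of_word (c, a @ r @ b, d) :: Y_word \<Rightarrow>\<^sub>0 'k::field)
    \<in> polys.span (T_word_poly ` T_words Y (rel_polys R) d c)"
  using assms(2-)
proof (induction arbitrary: m l n r c a b d)
  case (base x y)
  then have "Y_path m l n" "Y_path m r n"
    using assms(1) [of x y] by (auto simp: parallel_def)
  then have "((c, a, m), of_word (m, l, n) - of_word (m, r, n), (n, b, d))
      \<in> T_words Y (rel_polys R :: (Y_word \<Rightarrow>\<^sub>0 'k) set) d c"
    using base by (intro T_words_rel) auto
  then have "T_word_poly ((c, a, m), of_word (m, l, n) - of_word (m, r, n), (n, b, d))
      \<in> T_word_poly ` T_words Y (rel_polys R :: (Y_word \<Rightarrow>\<^sub>0 'k) set) d c"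
    by (rule imageI)
  then show ?case
    by (auto simp: T_word_poly_rel intro: polys.span_base)
next
  case (refl x)
  then show ?case by (simp add: polys.span_zero)
next
  case (sym x y)
  then show ?case by (metis minus_diff_eq polys.span_neg)
next
  case (trans x y z)
  obtain h where "y = (m, h, n)"
    using congruence_parallel [OF assms(1) trans.hyps(1)] trans.prems by (auto simp: parallel_def)
  then have "(of_word (c, a @ l @ b, d) - of_word (c, a @ h @ b, d)) +
      (of_word (c, a @ h @ b, d) - of_word (c, a @ r @ b, d) :: Y_word \<Rightarrow>\<^sub>0 'k)
    \<in> polys.span (T_word_poly ` T_words Y (rel_polys R) d c)"
    using trans.IH [of m _ n _ c a b d] trans.prems by (intro polys.span_add) auto
  then show ?case by simp
next
  case (comp x x' y y')
  obtain p q l1 r1 where 1: "x = (p, l1, q)" "x' = (p, r1, q)" "Y_path p l1 q" "Y_path p r1 q"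
    using congruence_parallel [OF assms(1) comp.hyps(1)] by (auto simp: parallel_def)
  obtain p' q' l2 r2 where 2: "y = (p', l2, q')" "y' = (p', r2, q')" "Y_path p' l2 q'"
      "Y_path p' r2 q'"
    using congruence_parallel [OF assms(1) comp.hyps(2)] by (auto simp: parallel_def)
  have eq: "p = m" "q' = n" "q = p'" "l = l1 @ l2" "r = r1 @ r2"
    using 1 2 comp.prems comp.hyps by (auto simp: composable_def word_cod_def word_dom_def)
  have "Y_path q (l2 @ b) d" "Y_path c (a @ r1) p'"
    using 1 2 eq comp.prems by (auto simp: Y_path_append)
  then have "(of_word (c, a @ l1 @ (l2 @ b), d) - of_word (c, a @ r1 @ (l2 @ b), d)) +
      (of_word (c, (a @ r1) @ l2 @ b, d) - of_word (c, (a @ r1) @ r2 @ b, d) :: Y_word \<Rightarrow>\<^sub>0 'k)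
    \<in> polys.span (T_word_poly ` T_words Y (rel_polys R) d c)"
    using 1 2 eq comp.prems comp.IH(1) [of m l1 p' r1 c a "l2 @ b" d]
      comp.IH(2) [of p' l2 n r2 c "a @ r1" b d]
    by (intro polys.span_add) auto
  then show ?case by (simp add: eq)
qed

section \<open>The relations \<open>\<rho>\<^sub>4\<close> and \<open>\<rho>\<^sub>5\<close> follow from the others\<close>

lemma Y_path_replicate_Tau: "Y_path c (replicate k (Tau q)) q \<longleftrightarrow> c = q"
  by (induction k arbitrary: c) auto

lemma Tau_power_Eps:
  assumes "1 \<le> q" "k \<le> i" "i \<le> q"
  shows "((q, replicate k (Tau q) @ [Eps q i], q - 1),
    (q, Eps q (i - k) # replicate k (Tau (q - 1)), q - 1)) \<in> congruence Y S"
  using assms(2)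
proof (induction k)
  case 0
  then show ?case using assms by (auto intro: congruence.refl simp: words_Y word_cod_def word_dom_def)
next
  case (Suc k)
  have "((q, [Tau q, Eps q (i - k)], q - 1), (q, [Eps q (i - k - 1), Tau (q - 1)], q - 1))
      \<in> congruence Y S"
    using assms Suc.prems by (intro congruence.base) (auto simp: S_def rel_rho1_def)
  from congruence_context [OF this, of q "[]" "replicate k (Tau (q - 1))" "q - 1"]
  have "((q, Tau q # Eps q (i - k) # replicate k (Tau (q - 1)), q - 1),
      (q, Eps q (i - Suc k) # replicate (Suc k) (Tau (q - 1)), q - 1)) \<in> congruence Y S"
    by (simp add: Y_path_replicate_Tau)
  moreover have "((q, replicate (Suc k) (Tau q) @ [Eps q i], q - 1),
      (q, Tau q # Eps q (i - k) # replicate k (Tau (q - 1)), q - 1)) \<in> congruence Y S"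
    using congruence_context [OF Suc.IH, of q "[Tau q]" "[]"] Suc.prems by simp
  ultimately show ?case
    by (rule congruence.trans [rotated])
qed

lemma Tau_power_Eta:
  assumes "k \<le> i" "i \<le> q"
  shows "((q, replicate k (Tau q) @ [Eta q i], q + 1),
    (q, Eta q (i - k) # replicate k (Tau (q + 1)), q + 1)) \<in> congruence Y S"
  using assms(1)
proof (induction k)
  case 0
  then show ?case using assms by (auto intro: congruence.refl simp: words_Y word_cod_def word_dom_def)
next
  case (Suc k)
  have "((q, [Tau q, Eta q (i - k)], q + 1), (q, [Eta q (i - k - 1), Tau (q + 1)], q + 1))
      \<in> congruence Y S"
    using assms Suc.prems by (intro congruence.base) (auto simp: S_def rel_rho2_def)
  from congruence_context [OF this, of q "[]" "replicate k (Tau (q + 1))" "q + 1"]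
  have "((q, Tau q # Eta q (i - k) # replicate k (Tau (q + 1)), q + 1),
      (q, Eta q (i - Suc k) # replicate (Suc k) (Tau (q + 1)), q + 1)) \<in> congruence Y S"
    by (simp add: Y_path_replicate_Tau)
  moreover have "((q, replicate (Suc k) (Tau q) @ [Eta q i], q + 1),
      (q, Tau q # Eta q (i - k) # replicate k (Tau (q + 1)), q + 1)) \<in> congruence Y S"
    using congruence_context [OF Suc.IH, of q "[Tau q]" "[]"] Suc.prems by simp
  ultimately show ?case
    by (rule congruence.trans [rotated])
qed

lemma Tau_power_order:
  "((q, Tau q # replicate q (Tau q), q), (q, [], q)) \<in> congruence Y S"
  by (rule congruence.base) (auto simp: S_def rel_rho3_def)

text \<open>Insert t_(q-1)^q = 1 on the right: t_q eps^0 = t_q eps^0 t_(q-1)^q = t_q t_q^q eps^q =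
  eps^q, where the middle equality is \<open>Tau_power_Eps\<close> with k = i = q, read
  backwards.\<close>

lemma rho4_congruence: "rel_rho4 \<subseteq> congruence Y S"
proof -
  have "((q, [Tau q, Eps q 0], q - 1), (q, [Eps q q], q - 1)) \<in> congruence Y S" if "1 \<le> q" for q
  proof -
    have "((q - 1, replicate q (Tau (q - 1)), q - 1), (q - 1, [], q - 1)) \<in> congruence Y S"
      using Tau_power_order [of "q - 1"] that by (cases q) auto
    from congruence_context [OF this, of q "[Tau q, Eps q 0]" "[]" "q - 1"]
    have 1: "((q, [Tau q, Eps q 0] @ replicate q (Tau (q - 1)), q - 1),
        (q, [Tau q, Eps q 0], q - 1)) \<in> congruence Y S"
      using that by simp
    have 2: "((q, Tau q # replicate q (Tau q) @ [Eps q q], q - 1),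
        (q, [Tau q, Eps q 0] @ replicate q (Tau (q - 1)), q - 1)) \<in> congruence Y S"
      using congruence_context [OF Tau_power_Eps [of q q q], of q "[Tau q]" "[]"] that by simp
    have 3: "((q, Tau q # replicate q (Tau q) @ [Eps q q], q - 1), (q, [Eps q q], q - 1))
        \<in> congruence Y S"
      using congruence_context [OF Tau_power_order [of q], of q "[]" "[Eps q q]" "q - 1"] that
      by simp
    show ?thesis
      using 1 2 3 by (meson congruence.sym congruence.trans)
  qed
  then show ?thesis by (auto simp: rel_rho4_def)
qed

text \<open>Here the identity inserted on the right is t_(q+1)^(q+2). Moving q of its factors to the
  left across the codegeneracy turns eta^0 into eta^q; the two remaining factors are the square in
  rho_5.\<close>

lemma rho5_congruence: "rel_rho5 \<subseteq> congruence Y S"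
proof -
  have "((q, [Tau q, Eta q 0], q + 1), (q, [Eta q q, Tau (q + 1), Tau (q + 1)], q + 1))
      \<in> congruence Y S" for q
  proof -
    let ?t = "Tau (q + 1)"
    have 1: "((q, [Tau q, Eta q 0] @ replicate q ?t @ [?t, ?t], q + 1),
        (q, [Tau q, Eta q 0], q + 1)) \<in> congruence Y S"
      using congruence_context [OF Tau_power_order [of "q + 1"], of q "[Tau q, Eta q 0]" "[]"]
      by (simp add: replicate_append_same [symmetric])
    have 2: "((q, Tau q # replicate q (Tau q) @ [Eta q q, ?t, ?t], q + 1),
        (q, [Tau q, Eta q 0] @ replicate q ?t @ [?t, ?t], q + 1)) \<in> congruence Y S"
      using congruence_context [OF Tau_power_Eta [of q q q], of q "[Tau q]" "[?t, ?t]"] by simp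
    have 3: "((q, Tau q # replicate q (Tau q) @ [Eta q q, ?t, ?t], q + 1),
        (q, [Eta q q, ?t, ?t], q + 1)) \<in> congruence Y S"
      using congruence_context [OF Tau_power_order [of q], of q "[]" "[Eta q q, ?t, ?t]" "q + 1"]
      by simp
    show ?thesis
      using 1 2 3 by (meson congruence.sym congruence.trans)
  qed
  then show ?thesis by (auto simp: rel_rho5_def)
qed

lemma S\<^sub>C_congruence: "S\<^sub>C \<subseteq> congruence Y S"
  using rho4_congruence rho5_congruence by (auto simp: S\<^sub>C_def intro: congruence.base)

lemma poly_ideal_S\<^sub>C:
  "poly_ideal Y (rel_polys S\<^sub>C :: (Y_word \<Rightarrow>\<^sub>0 'k::field) set) = poly_ideal Y (rel_polys S)"
proof -
  have SC: "parallel u v \<and> u \<noteq> v" if "(u, v) \<in> S\<^sub>C" for u v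
    using parallel_S\<^sub>C [OF that] rel_less\<^sub>2 [OF that] wf_less\<^sub>2 by auto
  have S: "parallel u v" if "(u, v) \<in> S" for u v
    using SC that by (auto simp: S\<^sub>C_def)
  have "polys.span (T_word_poly ` T_words Y (rel_polys S\<^sub>C :: (Y_word \<Rightarrow>\<^sub>0 'k) set) d c) =
      polys.span (T_word_poly ` T_words Y (rel_polys S) d c)" for c d
  proof (rule polys.span_eq [THEN iffD2], safe)
    fix a b and s :: "Y_word \<Rightarrow>\<^sub>0 'k"
    assume "(a, s, b) \<in> T_words Y (rel_polys S\<^sub>C) d c"
    then obtain m n as l r bs where *: "a = (c, as, m)" "b = (n, bs, d)"
      "((m, l, n), (m, r, n)) \<in> S\<^sub>C" "s = of_word (m, l, n) - of_word (m, r, n)"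
      "Y_path c as m" "Y_path n bs d"
      by (rule T_words_relE [OF _ SC])
    then show "T_word_poly (a, s, b) \<in> polys.span (T_word_poly ` T_words Y (rel_polys S) d c)"
      using S\<^sub>C_congruence
      by (auto simp: T_word_poly_rel intro!: congruence_span [OF S])
  next
    fix a b and s :: "Y_word \<Rightarrow>\<^sub>0 'k"
    assume "(a, s, b) \<in> T_words Y (rel_polys S) d c"
    then have "(a, s, b) \<in> T_words Y (rel_polys S\<^sub>C) d c"
      unfolding T_words_def rel_polys_def S\<^sub>C_def by blast
    then show "T_word_poly (a, s, b) \<in> polys.span (T_word_poly ` T_words Y (rel_polys S\<^sub>C) d c)"
      by (intro polys.span_base imageI)
  qed
  then show ?thesis
    by (simp add: poly_ideal_def)
qed

section \<open>Reduction to normal words\<close>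

definition eps_letters :: "nat \<Rightarrow> nat list \<Rightarrow> edge list" where
  "eps_letters p is = map (\<lambda>r. Eps (p - r) (is ! r)) [0..<length is]"

definition eta_letters :: "nat \<Rightarrow> nat list \<Rightarrow> edge list" where
  "eta_letters q js = map (\<lambda>r. Eta (q - length js + r) (js ! r)) [0..<length js]"

lemma normal_word_letters:
  "normal_word p q is js k =
    (p, eps_letters p is @ eta_letters q js @ replicate k (Tau q), q)"
  by (simp add: normal_word_def eps_letters_def eta_letters_def)

lemma eps_letters_Nil [simp]: "eps_letters p [] = []"
  by (simp add: eps_letters_def)

lemma eps_letters_Cons [simp]: "eps_letters p (i # is) = Eps p i # eps_letters (p - 1) is"
  by (simp add: eps_letters_def upt_conv_Cons map_Suc_upt [symmetric] del: upt_Suc)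

lemma eta_letters_Nil [simp]: "eta_letters q [] = []"
  by (simp add: eta_letters_def)

lemma eta_letters_Cons:
  assumes "length js < q"
  shows "eta_letters q (j # js) = Eta (q - Suc (length js)) j # eta_letters q js"
  using assms
  by (auto simp: eta_letters_def upt_conv_Cons map_Suc_upt [symmetric] Suc_diff_Suc simp del: upt_Suc)

text \<open>The lower indices are anchored at the domain, so removing the rightmost letter lowers q,
  while removing the leftmost does not. This form suits the action, in which the rightmost letter is
  applied first; the \<open>Cons\<close> form suits the reduction, which adds letters on the
  left.\<close>

lemma eta_letters_snoc:
  assumes "length js < q"
  shows "eta_letters q (js @ [j]) = eta_letters (q - 1) js @ [Eta (q - 1) j]"
  using assms by (auto simp: eta_letters_def nth_append)

lemma length_strictly_sorted_le:
  fixes js :: "nat list"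
  assumes "sorted_wrt (<) js" "\<forall>j\<in>set js. j < q"
  shows "length js \<le> q"
proof -
  have "length js = card (set js)"
    using assms(1) by (simp add: strict_sorted_iff distinct_card)
  also have "\<dots> \<le> card {..<q}"
    using assms(2) by (intro card_mono) auto
  finally show ?thesis by simp
qed

lemma normal_indices_Cons_Eps:
  "normal_indices p q (i # is) js k \<longleftrightarrow>
    0 < p \<and> i \<le> p \<and> (\<forall>i'\<in>set is. i' < i) \<and> normal_indices (p - 1) q is js k"
  (is "?L \<longleftrightarrow> ?R")
proof
  assume L: ?L
  \<comment> \<open>A strictly increasing list below q has at most q entries, so the dimension
    equation forces p to be positive.\<close>
  then have "length js \<le> q"
    by (auto simp: normal_indices_def intro: length_strictly_sorted_le)
  with L show ?R
    by (fastforce simp: normal_indices_def)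
next
  assume ?R
  then show ?L by (fastforce simp: normal_indices_def)
qed

lemma normal_indices_Cons_Eta:
  "normal_indices p q [] (j # js) k \<longleftrightarrow>
    j < q \<and> (\<forall>j'\<in>set js. j < j') \<and> normal_indices (p + 1) q [] js k"
  by (auto simp: normal_indices_def)

text \<open>Only the adjacent pairs \<open>\<epsilon>\<epsilon>\<close>, \<open>\<epsilon>\<eta>\<close>, \<open>\<epsilon>t\<close>, \<open>\<eta>\<eta>\<close>, \<open>\<eta>t\<close>, \<open>tt\<close> can avoid the leading words of
  \<open>S\<^sub>C\<close>, so putting a letter in front of a normal word yields either a normal word or a word with
  a leading word as a prefix.\<close>

definition reducible :: "nat \<Rightarrow> edge list \<Rightarrow> nat \<Rightarrow> bool" where
  "reducible c es d \<longleftrightarrow> (\<exists>a m l r n b. es = a @ l @ b \<and> ((m, l, n), (m, r, n)) \<in> S\<^sub>C \<and>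
     Y_path c a m \<and> Y_path n b d)"

lemma reducible_prefix:
  assumes "((c, l, n), (c, r, n)) \<in> S\<^sub>C" "Y_path n b d"
  shows "reducible c (l @ b) d"
  unfolding reducible_def using assms by (metis Y_path.simps(1) append_Nil)

lemma reducible_pair:
  assumes "((c, [e, e'], n), (c, r, n)) \<in> S\<^sub>C" "Y_path n b d"
  shows "reducible c (e # e' # b) d"
  using reducible_prefix [OF assms] by simp

lemma reducible_Cons:
  assumes "reducible (edge_tail e) es d" "e \<in> arcs Y"
  shows "reducible (edge_head e) (e # es) d"
  using assms unfolding reducible_def by (metis Y_path.simps(2) append_Cons)

lemma S\<^sub>C_Eps_Eps:
  assumes "i \<le> i'" "i' \<le> p" "0 < p"
  shows "((p + 1, [Eps (p + 1) i, Eps p i'], p - 1),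
    (p + 1, [Eps (p + 1) (i' + 1), Eps p i], p - 1)) \<in> S\<^sub>C"
proof -
  \<comment> \<open>This is \<open>rel_f\<close> with j = i' + 1, which turns the strict condition i
    < j into i <= i'.\<close>
  have "((p + 1, [Eps (p + 1) i, Eps p (Suc i' - 1)], p - 1),
      (p + 1, [Eps (p + 1) (Suc i'), Eps p i], p - 1)) \<in> rel_f"
    unfolding rel_f_def using assms by fastforce
  then show ?thesis by (simp add: S\<^sub>C_def S_def)
qed

lemma S\<^sub>C_Eta_Eta:
  assumes "i \<le> j" "j \<le> q"
  shows "((q, [Eta q j, Eta (q + 1) i], q + 2), (q, [Eta q i, Eta (q + 1) (j + 1)], q + 2)) \<in> S\<^sub>C"
  using assms by (auto simp: S\<^sub>C_def S_def rel_g_def)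

lemma S\<^sub>C_Eta_Eps:
  assumes "1 \<le> q" "j \<le> q - 1" "i \<le> q"
  obtains r where "((q - 1, [Eta (q - 1) j, Eps q i], q - 1), (q - 1, r, q - 1)) \<in> S\<^sub>C"
  using assms unfolding S\<^sub>C_def S_def rel_h_def by blast

lemma S\<^sub>C_Tau_Eps:
  assumes "1 \<le> q" "i \<le> q"
  obtains r where "((q, [Tau q, Eps q i], q - 1), (q, r, q - 1)) \<in> S\<^sub>C"
proof (cases "i = 0")
  case True
  then show ?thesis using that assms unfolding S\<^sub>C_def rel_rho4_def by blast
next
  case False
  then have "1 \<le> i" by simp
  then show ?thesis using that assms unfolding S\<^sub>C_def S_def rel_rho1_def by blast
qed

lemma S\<^sub>C_Tau_Eta:
  assumes "i \<le> q"
  obtains r where "((q, [Tau q, Eta q i], q + 1), (q, r, q + 1)) \<in> S\<^sub>C"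
proof (cases "i = 0")
  case True
  then show ?thesis using that unfolding S\<^sub>C_def rel_rho5_def by blast
next
  case False
  then have "1 \<le> i" by simp
  then show ?thesis using that assms unfolding S\<^sub>C_def S_def rel_rho2_def by blast
qed

lemma Eps_Cons_normal:
  assumes "Y_path (Suc p) (Eps (Suc p) i # es) d" "normal_indices p d is js k"
    "(p, es, d) = normal_word p d is js k"
  shows "reducible (Suc p) (Eps (Suc p) i # es) d \<or>
    (normal_indices (Suc p) d (i # is) js k \<and>
      (Suc p, Eps (Suc p) i # es, d) = normal_word (Suc p) d (i # is) js k)"
proof (cases "is = [] \<or> hd is < i")
  case True
  moreover have "sorted_wrt (>) is"
    using assms(2) by (simp add: normal_indices_def)
  ultimately have "\<forall>i'\<in>set is. i' < i"
    by (cases "is") auto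
  then show ?thesis
    using assms by (auto simp: normal_indices_Cons_Eps normal_word_letters)
next
  case False
  then obtain i' is' where *: "is = i' # is'" "i \<le> i'"
    by (cases "is") auto
  then have es: "es = Eps p i' # eps_letters (p - 1) is' @ eta_letters d js @ replicate k (Tau d)"
    using assms(3) by (simp add: normal_word_letters)
  have "i' \<le> p" "0 < p"
    using assms(1) es by auto
  note S\<^sub>C_Eps_Eps [OF *(2) this]
  then show ?thesis
    using assms unfolding es
    by (intro disjI1, intro reducible_pair [where n = "p - 1"]) auto
qed

lemma Eta_Cons_normal:
  assumes "Y_path p (Eta p j # es) d" "normal_indices (Suc p) d is js k"
    "(Suc p, es, d) = normal_word (Suc p) d is js k"
  shows "reducible p (Eta p j # es) d \<or>
    (normal_indices p d [] (j # js) k \<and> (p, Eta p j # es, d) = normal_word p d [] (j # js) k)"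
proof (cases "is")
  case (Cons i is')
  then have es: "es = Eps (Suc p) i # eps_letters p is' @ eta_letters d js @ replicate k (Tau d)"
    using assms(3) by (simp add: normal_word_letters)
  have "1 \<le> Suc p" "j \<le> Suc p - 1" "i \<le> Suc p"
    using assms es by auto
  then obtain r where "((Suc p - 1, [Eta (Suc p - 1) j, Eps (Suc p) i], Suc p - 1),
      (Suc p - 1, r, Suc p - 1)) \<in> S\<^sub>C"
    by (rule S\<^sub>C_Eta_Eps)
  then show ?thesis
    using assms unfolding es
    by (intro disjI1, intro reducible_pair [where n = p]) auto
next
  case Nil
  then have n: "d = Suc p + length js" and "sorted_wrt (<) js"
    using assms(2) by (auto simp: normal_indices_def)
  show ?thesis
  proof (cases "js = [] \<or> j < hd js")
    case True
    then have "\<forall>j'\<in>set js. j < j'"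
      using \<open>sorted_wrt (<) js\<close> by (cases js) auto
    then show ?thesis
      using assms Nil n by (auto simp: normal_indices_Cons_Eta normal_word_letters eta_letters_Cons)
  next
    case False
    then obtain j' js' where *: "js = j' # js'" "j' \<le> j"
      by (cases js) auto
    have es: "es = Eta (Suc p) j' # eta_letters d js' @ replicate k (Tau d)"
      using assms(3) n * Nil by (simp add: normal_word_letters eta_letters_Cons)
    show ?thesis
      using assms * S\<^sub>C_Eta_Eta [of j' j p] unfolding es
      by (intro disjI1, intro reducible_pair [where n = "p + 2"]) auto
  qed
qed

lemma Tau_Cons_normal:
  assumes "Y_path p (Tau p # es) d" "normal_indices p d is js k"
    "(p, es, d) = normal_word p d is js k"
  shows "reducible p (Tau p # es) d \<or>
    (normal_indices p d [] [] (Suc k) \<and> (p, Tau p # es, d) = normal_word p d [] [] (Suc k))"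
proof (cases "is")
  case (Cons i is')
  then have es: "es = Eps p i # eps_letters (p - 1) is' @ eta_letters d js @ replicate k (Tau d)"
    using assms(3) by (simp add: normal_word_letters)
  have "1 \<le> p" "i \<le> p"
    using assms es by auto
  then obtain r where "((p, [Tau p, Eps p i], p - 1), (p, r, p - 1)) \<in> S\<^sub>C"
    by (rule S\<^sub>C_Tau_Eps)
  then show ?thesis
    using assms unfolding es
    by (intro disjI1, intro reducible_pair [where n = "p - 1"]) auto
next
  case Nil
  then have n: "d = p + length js"
    using assms(2) by (auto simp: normal_indices_def)
  show ?thesis
  proof (cases js)
    case (Cons j js')
    have es: "es = Eta p j # eta_letters d js' @ replicate k (Tau d)"
      using assms(3) n Cons Nil by (simp add: normal_word_letters eta_letters_Cons)
    have "j \<le> p"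
      using assms es by auto
    then obtain r where "((p, [Tau p, Eta p j], p + 1), (p, r, p + 1)) \<in> S\<^sub>C"
      by (rule S\<^sub>C_Tau_Eta)
    then show ?thesis
      using assms unfolding es
      by (intro disjI1, intro reducible_pair [where n = "p + 1"]) auto
  next
    case js: Nil
    have es: "es = replicate k (Tau p)" "d = p"
      using assms(3) n js Nil by (simp_all add: normal_word_letters)
    show ?thesis
    \<comment> \<open>The largest admissible exponent is p; one more t completes the left-hand side
      of rho_3.\<close>
    proof (cases "k = p")
      case True
      have "((p, replicate (p + 1) (Tau p), p), (p, [], p)) \<in> S\<^sub>C"
        by (auto simp: S\<^sub>C_def S_def rel_rho3_def)
      then show ?thesis
        using reducible_prefix [of p _ p "[]" "[]" p] by (simp add: es True)
    next
      case False
      then show ?thesis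
        using assms(2) by (auto simp: es Nil js normal_word_letters normal_indices_def)
    qed
  qed
qed

lemma normal_or_reducible:
  assumes "Y_path c es d"
  shows "reducible c es d \<or>
    (\<exists>is js k. normal_indices c d is js k \<and> (c, es, d) = normal_word c d is js k)"
  using assms
proof (induction es arbitrary: c)
  case Nil
  then have "normal_indices c d [] [] 0" "(c, [], d) = normal_word c d [] [] 0"
    by (auto simp: normal_indices_def normal_word_letters)
  then show ?case by blast
next
  case (Cons e es)
  then have e: "e \<in> arcs Y" "c = edge_head e" and es: "Y_path (edge_tail e) es d"
    by auto
  show ?case
  proof (cases "reducible (edge_tail e) es d")
    case True
    then show ?thesis using e by (auto intro: reducible_Cons)
  next
    case False
    then obtain "is" js k where
      n: "normal_indices (edge_tail e) d is js k" "(edge_tail e, es, d) = normal_word (edge_tail e) d is js k"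
      using Cons.IH [OF es] by blast
    show ?thesis
    proof (cases e)
      case (Eps p i)
      then obtain p' where "p = Suc p'"
        using e by (cases p) auto
      then show ?thesis
        using Eps_Cons_normal [of p' i es d "is" js k] Cons.prems n e Eps by auto
    next
      case (Eta p j)
      then show ?thesis
        using Eta_Cons_normal [of p j es d "is" js k] Cons.prems n e by auto
    next
      case (Tau p)
      then show ?thesis
        using Tau_Cons_normal [of p es d "is" js k] Cons.prems n e by auto
    qed
  qed
qed

text \<open>A single well-founded induction carries all the claims. Rewriting l to r inside x = alb
  subtracts the product asb, whose leading word is x itself. If x lies below w, then by transitivity
  so do all later words, hence every product used is admissible modulo w. The bound w is quantified
  inside the induction so that the hypothesis applies to it after each rewriting.\<close>

lemma normal_form:
  assumes "Y_path c es d"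
  obtains "is" js k where "normal_indices c d is js k"
    "((c, es, d), normal_word c d is js k) \<in> congruence Y S"
    "\<And>w. ((c, es, d), w) \<in> less\<^sub>2 \<Longrightarrow> word_cod w = c \<Longrightarrow> word_dom w = d \<Longrightarrow>
      trivial_modulo Y less\<^sub>2 (rel_polys S\<^sub>C :: (Y_word \<Rightarrow>\<^sub>0 'k::field) set) w
        (of_word (c, es, d) - of_word (normal_word c d is js k))"
proof -
  let ?T = "rel_polys S\<^sub>C :: (Y_word \<Rightarrow>\<^sub>0 'k) set"
  have "\<exists>is js k. normal_indices c d is js k \<and>
      (x, normal_word c d is js k) \<in> congruence Y S \<and>
      (\<forall>w. (x, w) \<in> less\<^sub>2 \<longrightarrow> word_cod w = c \<longrightarrow> word_dom w = d \<longrightarrow>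
        trivial_modulo Y less\<^sub>2 ?T w (of_word x - of_word (normal_word c d is js k)))"
    if "x = (c, es, d)" "Y_path c es d" for x es
    using wf_less\<^sub>2 that
  proof (induction x arbitrary: es rule: wf_induct_rule)
    case (less x)
    show ?case
    proof (cases "reducible c es d")
      case True
      then obtain a m l r n b where es: "es = a @ l @ b"
        and lr: "((m, l, n), (m, r, n)) \<in> S\<^sub>C" and a: "Y_path c a m" and b: "Y_path n b d"
        by (auto simp: reducible_def)
      let ?y = "(c, a @ r @ b, d)"
      have p: "Y_path m l n" "Y_path m r n"
        using parallel_S\<^sub>C [OF lr] by (auto simp: parallel_def)
      have less': "(?y, x) \<in> less\<^sub>2"
        using less\<^sub>2_prepend [OF less\<^sub>2_append [OF rel_less\<^sub>2 [OF lr] b] a] by (simp add: es less.prems)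
      have "Y_path c (a @ r @ b) d"
        using a b p by (auto simp: Y_path_append)
      then obtain "is" js k where ih: "normal_indices c d is js k"
        "(?y, normal_word c d is js k) \<in> congruence Y S"
        "\<forall>w. (?y, w) \<in> less\<^sub>2 \<longrightarrow> word_cod w = c \<longrightarrow> word_dom w = d \<longrightarrow>
          trivial_modulo Y less\<^sub>2 ?T w (of_word ?y - of_word (normal_word c d is js k))"
        using less.IH [OF less' HOL.refl] by blast
      have "(x, ?y) \<in> congruence Y S"
        using congruence_context [OF _ a b] lr S\<^sub>C_congruence by (auto simp: less.prems es)
      then have "(x, normal_word c d is js k) \<in> congruence Y S"
        using ih(2) by (rule congruence.trans)
      moreover have "trivial_modulo Y less\<^sub>2 ?T w (of_word x - of_word (normal_word c d is js k))"
        if w: "(x, w) \<in> less\<^sub>2" "word_cod w = c" "word_dom w = d" for w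
      proof -
        let ?s = "of_word (m, l, n) - of_word (m, r, n) :: Y_word \<Rightarrow>\<^sub>0 'k"
        have "lead_word less\<^sub>2 ?s = (m, l, n)"
          using lead_word_diff [OF wf_less\<^sub>2 rel_less\<^sub>2 [OF lr]] .
        then have "((c, a, m), ?s, (n, b, d)) \<in>
            {(a, s, b) \<in> T_words Y ?T (word_dom w) (word_cod w). (a \<cdot> lead_word less\<^sub>2 s \<cdot> b, w) \<in> less\<^sub>2}"
          using T_words_rel [OF lr p a b] w less.prems by (simp add: es)
        then have "trivial_modulo Y less\<^sub>2 ?T w (T_word_poly ((c, a, m), ?s, (n, b, d)))"
          unfolding trivial_modulo_def by (intro polys.span_base imageI)
        then have "trivial_modulo Y less\<^sub>2 ?T w (of_word x - of_word ?y)"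
          by (simp add: T_word_poly_rel less.prems es)
        moreover have "trivial_modulo Y less\<^sub>2 ?T w (of_word ?y - of_word (normal_word c d is js k))"
          using ih(3) w transD [OF trans_less\<^sub>2 less' w(1)] by blast
        ultimately have "trivial_modulo Y less\<^sub>2 ?T w
            ((of_word x - of_word ?y) + (of_word ?y - of_word (normal_word c d is js k)))"
          unfolding trivial_modulo_def by (rule polys.span_add)
        then show ?thesis by simp
      qed
      ultimately show ?thesis
        using ih(1) by blast
    next
      case False
      then obtain "is" js k where n: "normal_indices c d is js k" "x = normal_word c d is js k"
        using normal_or_reducible less.prems by blast
      have "(x, x) \<in> congruence Y S"
        using less.prems by (intro congruence.refl) (auto simp: words_Y word_cod_def word_dom_def)
      then have "(x, normal_word c d is js k) \<in> congruence Y S \<and>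
          (\<forall>w. trivial_modulo Y less\<^sub>2 ?T w (of_word x - of_word (normal_word c d is js k)))"
        by (simp add: n(2) [symmetric] trivial_modulo_def polys.span_zero)
      then show ?thesis using n(1) by blast
    qed
  qed
  from this [OF HOL.refl assms] show ?thesis
    using that by blast
qed

section \<open>The action on the integers\<close>

text \<open>Closed forms of the coface and codegeneracy maps, extended so that translation by \<open>q + 1\<close>
  in the source \<open>[q]\<close> becomes translation by \<open>p + 1\<close> in the target \<open>[p]\<close>.\<close>

fun act :: "edge \<Rightarrow> int \<Rightarrow> int" where
  "act (Eps p i) x = x + (x + int p - int i) div int p"
| "act (Eta q j) x = x - (x + int q + 1 - int j) div (int q + 2)"
| "act (Tau q) x = x - 1"

lemma act_shift:
  assumes "e \<in> arcs Y"
  shows "act e (x + s * (int (edge_tail e) + 1)) = act e x + s * (int (edge_head e) + 1)"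
proof (cases e)
  case (Eps p i)
  then obtain m where p: "p = Suc m"
    using assms by (cases p) auto
  have "(x + s * int p + int p - int i) div int p = (s * int p + (x + int p - int i)) div int p"
    by (simp add: algebra_simps)
  also have "\<dots> = s + (x + int p - int i) div int p"
    using p by (intro div_mult_self3) simp
  finally have "act (Eps p i) (x + s * int p) = act (Eps p i) x + s * (int p + 1)"
    by (simp add: distrib_left)
  moreover have "int (p - 1) + 1 = int p"
    by (simp add: p)
  ultimately show ?thesis
    by (simp only: Eps edge_tail.simps edge_head.simps)
next
  case (Eta q j)
  have "(x + s * (int q + 2) + int q + 1 - int j) div (int q + 2) =
      (s * (int q + 2) + (x + int q + 1 - int j)) div (int q + 2)"
    by (simp add: algebra_simps)
  also have "\<dots> = s + (x + int q + 1 - int j) div (int q + 2)"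
    by (intro div_mult_self3) simp
  finally have "(x + s * (int q + 2) + int q + 1 - int j) div (int q + 2) =
      s + (x + int q + 1 - int j) div (int q + 2)" .
  moreover have "int (q + 1) + 1 = int q + 2"
    by simp
  ultimately show ?thesis
    by (simp add: Eta algebra_simps)
next
  case (Tau q)
  then show ?thesis by simp
qed

lemma foldr_act_shift:
  assumes "Y_path c es d"
  shows "foldr act es (x + s * (int d + 1)) = foldr act es x + s * (int c + 1)"
  using assms
proof (induction es arbitrary: c)
  case (Cons e es)
  then have "foldr act es (x + s * (int d + 1)) = foldr act es x + s * (int (edge_tail e) + 1)"
    by simp
  then show ?case
    using Cons.prems act_shift [of e "foldr act es x" s] by simp
qed simp

lemma act_Eps_eq:
  assumes "i \<le> p" "0 \<le> x" "x < int p"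
  shows "act (Eps p i) x = (if x < int i then x else x + 1)"
proof (cases "x < int i")
  case True
  then have "(x + int p - int i) div int p = 0"
    using assms by (intro div_pos_pos_trivial) auto
  then show ?thesis using True by simp
next
  case False
  then have "(x + int p - int i) div int p = 1"
    using assms by (intro int_div_pos_eq [where r = "x - int i"]) auto
  then show ?thesis using False by simp
qed

lemma act_Eta_eq:
  assumes "j \<le> q" "0 \<le> x" "x \<le> int q + 1"
  shows "act (Eta q j) x = (if x \<le> int j then x else x - 1)"
proof (cases "x \<le> int j")
  case True
  then have "(x + int q + 1 - int j) div (int q + 2) = 0"
    using assms by (intro div_pos_pos_trivial) auto
  then show ?thesis using True by simp
next
  case False
  then have "(x + int q + 1 - int j) div (int q + 2) = 1"
    using assms by (intro int_div_pos_eq [where r = "x - int j - 1"]) auto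
  then show ?thesis using False by simp
qed

text \<open>{0..d} is a fundamental domain for translation by d + 1, and both sides turn that
  translation into the same one. The relations f, g and h thereby reduce to the usual simplicial
  identities on finite intervals.\<close>

lemma foldr_act_eqI:
  assumes "Y_path c l d" "Y_path c r d"
    "\<And>x. 0 \<le> x \<Longrightarrow> x \<le> int d \<Longrightarrow> foldr act l x = foldr act r x"
  shows "foldr act l x = foldr act r x"
proof -
  let ?x = "x mod (int d + 1)" and ?s = "x div (int d + 1)"
  have "0 \<le> ?x" "?x \<le> int d"
    using pos_mod_bound [of "int d + 1" x] by auto
  then have "foldr act l (?x + ?s * (int d + 1)) = foldr act r (?x + ?s * (int d + 1))"
    using assms by (simp only: foldr_act_shift)
  then show ?thesis by (simp only: mod_div_mult_eq)
qed

definition act_equiv :: "Y_word \<Rightarrow> Y_word \<Rightarrow> bool" where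
  "act_equiv x y \<longleftrightarrow> (\<exists>s. \<forall>z. foldr act (fst (snd x)) z =
     foldr act (fst (snd y)) z + s * (int (word_cod x) + 1))"

lemma act_equiv_eqI:
  assumes "Y_path c l d" "Y_path c r d"
    "\<And>x. 0 \<le> x \<Longrightarrow> x \<le> int d \<Longrightarrow> foldr act l x = foldr act r x"
  shows "act_equiv (c, l, d) (c, r, d)"
  unfolding act_equiv_def using foldr_act_eqI [OF assms] by (intro exI [of _ 0]) auto

lemma image_foldr_act_append:
  "foldr act (xs @ ys) ` A = foldr act xs ` foldr act ys ` A"
  by (simp add: image_image)

lemma funpow_act_Tau: "(act (Tau q) ^^ k) x = x - int k"
  by (induction k) auto

lemma act_equiv_rel_f: "(u, v) \<in> rel_f \<Longrightarrow> act_equiv u v"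
  by (auto simp: rel_f_def act_Eps_eq simp del: act.simps intro!: act_equiv_eqI)

lemma act_equiv_rel_g: "(u, v) \<in> rel_g \<Longrightarrow> act_equiv u v"
  by (auto simp: rel_g_def act_Eta_eq simp del: act.simps intro!: act_equiv_eqI)

lemma act_equiv_rel_h: "(u, v) \<in> rel_h \<Longrightarrow> act_equiv u v"
  by (auto simp: rel_h_def act_Eta_eq act_Eps_eq simp del: act.simps intro!: act_equiv_eqI)

lemma act_equiv_S:
  assumes "(u, v) \<in> S"
  shows "act_equiv u v"
proof -
  \<comment> \<open>For rho_1 and rho_2 the closed formulas agree at every integer: lowering both x
    and the upper index by 1 leaves the numerator of the quotient unchanged.\<close>
  have "act_equiv u v" if "(u, v) \<in> rel_rho1"
    using that
    by (auto simp: rel_rho1_def act_equiv_def of_nat_diff algebra_simps intro!: exI [of _ 0])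
  moreover have "act_equiv u v" if "(u, v) \<in> rel_rho2"
    using that
    by (auto simp: rel_rho2_def act_equiv_def of_nat_diff algebra_simps intro!: exI [of _ 0])
  \<comment> \<open>t_q^(q+1) lowers x by exactly one period, hence the witness -1.\<close>
  moreover have "act_equiv u v" if "(u, v) \<in> rel_rho3"
    using that
    by (auto simp: rel_rho3_def act_equiv_def word_cod_def funpow_act_Tau
        simp del: replicate_Suc intro!: exI [of _ "-1"])
  ultimately show ?thesis
    using assms act_equiv_rel_f [of u v] act_equiv_rel_g [of u v] act_equiv_rel_h [of u v]
    unfolding S_def by blast
qed

lemma parallel_congruence_S: "(x, y) \<in> congruence Y S \<Longrightarrow> parallel x y"
  by (rule congruence_parallel [of S]) (auto simp: S\<^sub>C_def intro: parallel_S\<^sub>C)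

lemma act_equiv_congruence: "(x, y) \<in> congruence Y S \<Longrightarrow> act_equiv x y"
proof (induction rule: congruence.induct)
  case (base x y)
  then show ?case by (rule act_equiv_S)
next
  case (refl x)
  then show ?case by (auto simp: act_equiv_def intro: exI [of _ 0])
next
  case (sym x y)
  then obtain s where "\<forall>z. foldr act (fst (snd x)) z =
      foldr act (fst (snd y)) z + s * (int (word_cod x) + 1)"
    by (auto simp: act_equiv_def)
  moreover have "word_cod x = word_cod y"
    using parallel_congruence_S [OF sym.hyps] by (auto simp: parallel_def word_cod_def)
  ultimately show ?case
    by (auto simp: act_equiv_def intro!: exI [of _ "- s"])
next
  case (trans x y z)
  then obtain s s' where "\<forall>w. foldr act (fst (snd x)) w =
      foldr act (fst (snd y)) w + s * (int (word_cod x) + 1)"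
    "\<forall>w. foldr act (fst (snd y)) w = foldr act (fst (snd z)) w + s' * (int (word_cod y) + 1)"
    by (auto simp: act_equiv_def)
  moreover have "word_cod x = word_cod y"
    using parallel_congruence_S [OF trans.hyps(1)] by (auto simp: parallel_def word_cod_def)
  ultimately show ?case
    by (auto simp: act_equiv_def algebra_simps intro!: exI [of _ "s + s'"])
next
  case (comp x x' y y')
  obtain c m l l' where x: "x = (c, l, m)" "x' = (c, l', m)" "Y_path c l m" "Y_path c l' m"
    using parallel_congruence_S [OF comp.hyps(1)] by (auto simp: parallel_def)
  have m: "word_cod y = m"
    using comp.hyps(3) by (simp add: x composable_def word_dom_def)
  obtain s s' where "\<forall>z. foldr act l z = foldr act l' z + s * (int c + 1)"
    "\<forall>z. foldr act (fst (snd y)) z = foldr act (fst (snd y')) z + s' * (int m + 1)"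
    using comp.IH m by (auto simp: act_equiv_def x word_cod_def)
  \<comment> \<open>Passing through the left factor turns s' periods of [m] into s' periods of [c],
    so the numbers of periods add up.\<close>
  then have "\<forall>z. foldr act (fst (snd (x \<cdot> y))) z =
      foldr act (fst (snd (x' \<cdot> y'))) z + (s + s') * (int c + 1)"
    by (simp add: x(1,2) word_comp_def foldr_act_shift [OF x(4)] distrib_right)
  moreover have "word_cod (x \<cdot> y) = c"
    by (simp add: x word_comp_def word_cod_def)
  ultimately show ?case
    unfolding act_equiv_def by (intro exI [of _ "s + s'"]) simp
qed

section \<open>Uniqueness of normal words\<close>

lemma strict_mono_act_Eps: "strict_mono (act (Eps p i))"
proof (rule strict_monoI)
  fix x y :: int
  assume "x < y"
  \<comment> \<open>For p = 0 both quotients are 0, the value of division by zero.\<close>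
  then have "(x + int p - int i) div int p \<le> (y + int p - int i) div int p"
    by (cases "p = 0") (auto intro: zdiv_mono1)
  then show "act (Eps p i) x < act (Eps p i) y"
    using \<open>x < y\<close> by simp
qed

lemma strict_mono_eps_letters: "strict_mono (foldr act (eps_letters p is))"
proof (induction "is" arbitrary: p)
  case (Cons i "is")
  then show ?case
    using strict_mono_act_Eps [of p i] by (simp add: strict_mono_def del: act.simps)
qed (simp add: strict_mono_def)

text \<open>A coface skips exactly one value. The outermost index i exceeds all the others, so the
  shift of the values from i upwards leaves the values already missing in place, and i is added to
  them.\<close>

lemma eps_letters_image:
  assumes "sorted_wrt (>) is" "\<forall>i\<in>set is. i \<le> p" "length is \<le> p"
  shows "foldr act (eps_letters p is) ` {0..int (p - length is)} = {0..int p} - int ` set is"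
  using assms
proof (induction "is" arbitrary: p)
  case (Cons i "is")
  have p: "int (p - 1) = int p - 1" "i \<le> p" "\<forall>i'\<in>set is. i' < i"
    using Cons.prems by auto
  have "foldr act (eps_letters (p - 1) is) ` {0..int (p - 1 - length is)} =
      {0..int (p - 1)} - int ` set is"
    using Cons.prems by (intro Cons.IH) fastforce+
  moreover have "foldr act (eps_letters p (i # is)) ` A =
      act (Eps p i) ` foldr act (eps_letters (p - 1) is) ` A" for A
    by (simp add: image_image)
  moreover have "p - length (i # is) = p - 1 - length is"
    by simp
  ultimately have "foldr act (eps_letters p (i # is)) ` {0..int (p - length (i # is))} =
      act (Eps p i) ` ({0..int p - 1} - int ` set is)"
    by (simp only: p(1))
  also have "\<dots> = (\<lambda>x. if x < int i then x else x + 1) ` ({0..int p - 1} - int ` set is)"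
    using p by (intro image_cong refl act_Eps_eq) auto
  also have "\<dots> = {0..int p} - int ` set (i # is)"
  proof (intro equalityI subsetI)
    fix y
    assume y: "y \<in> {0..int p} - int ` set (i # is)"
    show "y \<in> (\<lambda>x. if x < int i then x else x + 1) ` ({0..int p - 1} - int ` set is)"
    proof (cases "y < int i")
      case True
      then show ?thesis using y p by (intro image_eqI [of _ _ y]) auto
    next
      case False
      then show ?thesis using y p by (intro image_eqI [of _ _ "y - 1"]) auto
    qed
  qed (use p in \<open>auto split: if_splits\<close>)
  finally show ?case .
qed simp

text \<open>The rightmost codegeneracy acts first and has the largest index j. It identifies j with
  j + 1; the repetitions caused by the other letters occur strictly below j, where it is the
  identity. Hence the induction removes the last entry.\<close>

lemma eta_letters_act:
  assumes "sorted_wrt (<) js" "\<forall>j\<in>set js. j < q"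
  shows "foldr act (eta_letters q js) ` {0..int q} = {0..int (q - length js)} \<and>
    (\<forall>x. 0 \<le> x \<and> x < int q \<longrightarrow>
      foldr act (eta_letters q js) x = foldr act (eta_letters q js) (x + 1) \<longleftrightarrow> nat x \<in> set js)"
  using assms
proof (induction js arbitrary: q rule: rev_induct)
  case (snoc j js)
  let ?H = "foldr act (eta_letters (q - 1) js)"
  have j: "j < q" "\<forall>j'\<in>set js. j' < j" "sorted_wrt (<) js"
    using snoc.prems by (auto simp: sorted_wrt_append)
  have js: "\<forall>j'\<in>set js. j' < q - 1"
    using j by fastforce
  have len: "length js < q"
    using length_strictly_sorted_le [OF snoc.prems] by simp
  have q: "int (q - 1) = int q - 1"
    using j by simp
  have eta: "act (Eta (q - 1) j) x = (if x \<le> int j then x else x - 1)"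
    if "0 \<le> x" "x \<le> int q" for x
    using that j by (intro act_Eta_eq) auto
  have ih: "?H ` {0..int q - 1} = {0..int (q - 1 - length js)}"
    "\<And>x. 0 \<le> x \<Longrightarrow> x < int q - 1 \<Longrightarrow> ?H x = ?H (x + 1) \<longleftrightarrow> nat x \<in> set js"
    using snoc.IH [OF j(3) js] q by auto
  have "act (Eta (q - 1) j) ` {0..int q} = (\<lambda>x. if x \<le> int j then x else x - 1) ` {0..int q}"
    using eta by (intro image_cong refl) auto
  also have "\<dots> = {0..int q - 1}"
  proof (intro equalityI subsetI)
    fix y
    assume y: "y \<in> {0..int q - 1}"
    show "y \<in> (\<lambda>x. if x \<le> int j then x else x - 1) ` {0..int q}"
    proof (cases "y \<le> int j")
      case True
      then show ?thesis using y by (intro image_eqI [of _ _ y]) auto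
    next
      case False
      then show ?thesis using y by (intro image_eqI [of _ _ "y + 1"]) auto
    qed
  qed (use j in \<open>auto split: if_splits\<close>)
  finally have "foldr act (eta_letters q (js @ [j])) ` {0..int q} = {0..int (q - length (js @ [j]))}"
    using ih(1)
    by (simp add: eta_letters_snoc [OF len] image_foldr_act_append del: act.simps foldr_append)
  moreover have "foldr act (eta_letters q (js @ [j])) x = foldr act (eta_letters q (js @ [j])) (x + 1)
      \<longleftrightarrow> nat x \<in> set (js @ [j])" if x: "0 \<le> x" "x < int q" for x
  proof -
    have eq: "foldr act (eta_letters q (js @ [j])) x = ?H (if x \<le> int j then x else x - 1)"
      "foldr act (eta_letters q (js @ [j])) (x + 1) = ?H (if x + 1 \<le> int j then x + 1 else x)"
      using x by (simp_all add: eta_letters_snoc [OF len] eta del: act.simps One_nat_def)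
    consider "x < int j" | "x = int j" | "int j < x"
      by linarith
    then show ?thesis
    proof cases
      case 1
      then show ?thesis using x j ih(2) [of x] by (auto simp: eq)
    next
      case 2
      then show ?thesis unfolding eq by simp
    next
      case 3
      moreover have "j < nat x" "j \<le> nat (x - 1)"
        using 3 by linarith+
      then have "nat (x - 1) \<notin> set js" "nat x \<notin> set (js @ [j])"
        using j(2) by auto
      ultimately show ?thesis using 3 x ih(2) [of "x - 1"] by (auto simp: eq)
    qed
  qed
  ultimately show ?case by blast
qed simp

lemma normal_word_unique:
  assumes n: "normal_indices p q is js k" "normal_indices p q is' js' k'"
    and cong: "(normal_word p q is js k, normal_word p q is' js' k') \<in> congruence Y S"
  shows "(is, js, k) = (is', js', k')"
proof -
  define \<mu> where "\<mu> is js = foldr act (eps_letters p is @ eta_letters q js)" for "is" js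
  have image: "\<mu> is js ` {0..int q} = {0..int p} - int ` set is"
    and eq_iff: "0 \<le> x \<Longrightarrow> x < int q \<Longrightarrow> \<mu> is js x = \<mu> is js (x + 1) \<longleftrightarrow> nat x \<in> set js"
    if "normal_indices p q is js k" for "is" js k x
  proof -
    have js: "sorted_wrt (<) js" "\<forall>j\<in>set js. j < q"
      using that by (auto simp: normal_indices_def)
    have "length js \<le> q"
      by (rule length_strictly_sorted_le [OF js])
    then have len: "length is \<le> p" "q - length js = p - length is"
      using that by (auto simp: normal_indices_def)
    have "foldr act (eps_letters p is) ` {0..int (p - length is)} = {0..int p} - int ` set is"
      using that len by (intro eps_letters_image) (auto simp: normal_indices_def)
    then show "\<mu> is js ` {0..int q} = {0..int p} - int ` set is"
      using eta_letters_act [OF js] len(2) by (simp only: \<mu>_def image_foldr_act_append)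
    show "\<mu> is js x = \<mu> is js (x + 1) \<longleftrightarrow> nat x \<in> set js" if "0 \<le> x" "x < int q"
      using eta_letters_act [OF js] that strict_mono_eq [OF strict_mono_eps_letters [of p "is"]]
      by (simp add: \<mu>_def)
  qed
  have range: "0 \<le> \<mu> is js x \<and> \<mu> is js x \<le> int p"
    if "normal_indices p q is js k" "0 \<le> x" "x \<le> int q" for "is" js k x
    using image [OF that(1)] that by (metis (no_types, lifting) DiffD1 atLeastAtMost_iff imageI)
  have shift: "\<mu> is js (x + s * (int q + 1)) = \<mu> is js x + s * (int p + 1)"
    if "parallel (normal_word p q is js k) w" for "is" js k w x s
  proof -
    have "Y_path p (eps_letters p is @ eta_letters q js) q"
      using that by (auto simp: parallel_def normal_word_letters Y_path_append Y_path_replicate_Tau)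
    then show ?thesis
      unfolding \<mu>_def by (rule foldr_act_shift)
  qed
  \<comment> \<open>The assumption k' <= k makes the offset k - k' a natural number; the opposite
    case follows by symmetry of the congruence.\<close>
  have step: "k = k' \<and> (\<forall>x. \<mu> is js x = \<mu> is' js' x)"
    if n: "normal_indices p q is js k" "normal_indices p q is' js' k'"
      and cong: "(normal_word p q is js k, normal_word p q is' js' k') \<in> congruence Y S"
      and le: "k' \<le> k"
    for "is" js k is' js' k'
  proof -
    obtain s where s: "\<forall>z. \<mu> is js (z - int k) = \<mu> is' js' (z - int k') + s * (int p + 1)"
      using act_equiv_congruence [OF cong]
      by (auto simp: act_equiv_def normal_word_letters funpow_act_Tau \<mu>_def word_cod_def)
    have eq: "\<mu> is js z = \<mu> is' js' (z + int (k - k')) + s * (int p + 1)" for z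
      using s [rule_format, of "z + int k"] le by (simp add: algebra_simps of_nat_diff)
    have d: "int (k - k') \<le> int q"
      using n by (auto simp: normal_indices_def)
    \<comment> \<open>At z = 0 both arguments lie in {0..q}, so both values lie in {0..p} and differ
      by less than a period.\<close>
    have "s = 0"
    proof -
      have "\<bar>s * (int p + 1)\<bar> < int p + 1"
        using eq [of 0] range [OF n(1), of 0] range [OF n(2), of "int (k - k')"] d by auto
      then have "\<bar>s\<bar> * (int p + 1) < 1 * (int p + 1)"
        by (simp add: abs_mult)
      then have "\<bar>s\<bar> < 1"
        by (rule mult_right_less_imp_less) simp
      then show ?thesis by simp
    qed
    \<comment> \<open>A positive offset would move the argument z = q beyond the fundamental domain:
      the right-hand side would be at least p + 1, while the left-hand side is at most p.\<close>
    moreover have "k - k' = 0"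
    proof (rule ccontr)
      assume "k - k' \<noteq> 0"
      moreover have "parallel (normal_word p q is' js' k') (normal_word p q is js k)"
        by (rule parallel_congruence_S [OF congruence.sym [OF cong]])
      from shift [OF this, of "int (k - k') - 1" 1]
      have "\<mu> is' js' (int q + int (k - k')) = \<mu> is' js' (int (k - k') - 1) + (int p + 1)"
        by (simp add: algebra_simps)
      ultimately show False
        using eq [of "int q"] range [OF n(1), of "int q"] range [OF n(2), of "int (k - k') - 1"] d
          \<open>s = 0\<close> by auto
    qed
    ultimately show ?thesis
      using eq le by auto
  qed
  have "k = k' \<and> (\<forall>x. \<mu> is js x = \<mu> is' js' x)"
  proof (cases "k' \<le> k")
    case True
    then show ?thesis by (rule step [OF n cong])
  next
    case False
    then have "k' = k \<and> (\<forall>x. \<mu> is' js' x = \<mu> is js x)"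
      by (intro step [OF n(2,1) congruence.sym [OF cong]]) simp
    then show ?thesis by metis
  qed
  then have k: "k = k'" and \<mu>: "\<mu> is js x = \<mu> is' js' x" for x
    by auto
  have "{0..int p} - int ` set is = {0..int p} - int ` set is'"
    using image [OF n(1)] image [OF n(2)] \<mu> by simp
  moreover have "int ` set is \<subseteq> {0..int p}" "int ` set is' \<subseteq> {0..int p}"
    using n by (auto simp: normal_indices_def)
  ultimately have "int ` set is = int ` set is'"
    by blast
  then have "set is = set is'"
    by (simp add: inj_image_eq_iff)
  moreover have "sorted_wrt (<) (rev is)" "sorted_wrt (<) (rev is')"
    using n by (auto simp: normal_indices_def sorted_wrt_rev)
  ultimately have "rev is = rev is'"
    by (intro strict_sorted_equal) auto
  have "j \<in> set js \<longleftrightarrow> j \<in> set js'" if "j < q" for j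
    using that eq_iff [OF n(1), of "int j"] eq_iff [OF n(2), of "int j"] \<mu> by simp
  moreover have "\<forall>j\<in>set js. j < q" "\<forall>j\<in>set js'. j < q"
    using n by (auto simp: normal_indices_def)
  ultimately have "set js = set js'"
    by blast
  then have "js = js'"
    using n by (intro strict_sorted_equal) (auto simp: normal_indices_def)
  with k \<open>rev is = rev is'\<close> show ?thesis by simp
qed

section \<open>Triviality of the compositions\<close>

lemma congruent_trivial_modulo:
  assumes "(x, y) \<in> congruence Y S" "(x, w) \<in> less\<^sub>2" "(y, w) \<in> less\<^sub>2" "parallel x w"
  shows "trivial_modulo Y less\<^sub>2 (rel_polys S\<^sub>C :: (Y_word \<Rightarrow>\<^sub>0 'k::field) set) w
    (of_word x - of_word y)"
proof -
  let ?triv = "trivial_modulo Y less\<^sub>2 (rel_polys S\<^sub>C :: (Y_word \<Rightarrow>\<^sub>0 'k) set) w"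
  obtain c d l r where xy: "x = (c, l, d)" "y = (c, r, d)" "Y_path c l d" "Y_path c r d"
    using parallel_congruence_S [OF assms(1)] by (auto simp: parallel_def)
  have w: "word_cod w = c" "word_dom w = d"
    using assms(4) xy by (auto simp: parallel_def word_cod_def word_dom_def)
  obtain "is" js k where x: "normal_indices c d is js k"
    "(x, normal_word c d is js k) \<in> congruence Y S"
    "?triv (of_word x - of_word (normal_word c d is js k))"
    using assms(2) w xy by (elim normal_form [where 'k = 'k]) auto
  obtain is' js' k' where y: "normal_indices c d is' js' k'"
    "(y, normal_word c d is' js' k') \<in> congruence Y S"
    "?triv (of_word y - of_word (normal_word c d is' js' k'))"
    using assms(3) w xy by (elim normal_form [where 'k = 'k]) auto
  have "(normal_word c d is js k, normal_word c d is' js' k') \<in> congruence Y S"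
    using x(2) y(2) assms(1) by (meson congruence.sym congruence.trans)
  then have "(is, js, k) = (is', js', k')"
    by (rule normal_word_unique [OF x(1) y(1)])
  then have "?triv (of_word y - of_word (normal_word c d is js k))"
    using y(3) by simp
  with x(3) have "?triv ((of_word x - of_word (normal_word c d is js k)) -
      (of_word y - of_word (normal_word c d is js k)))"
    unfolding trivial_modulo_def by (rule polys.span_diff)
  then show ?thesis by simp
qed

lemma gs_basis_S\<^sub>C: "gs_basis Y less\<^sub>2 (rel_polys S\<^sub>C :: (Y_word \<Rightarrow>\<^sub>0 'k::field) set)"
proof -
  let ?T = "rel_polys S\<^sub>C :: (Y_word \<Rightarrow>\<^sub>0 'k) set"
  have lead: "lead_word less\<^sub>2 (of_word u - of_word v :: Y_word \<Rightarrow>\<^sub>0 'k) = u" if "(u, v) \<in> S\<^sub>C" for u v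
    using lead_word_diff [OF wf_less\<^sub>2 rel_less\<^sub>2 [OF that]] .
  have poly: "f \<in> polys Y \<and> monic less\<^sub>2 f" if "f \<in> ?T" for f
  proof -
    obtain u v where uv: "(u, v) \<in> S\<^sub>C" "f = of_word u - of_word v"
      using \<open>f \<in> ?T\<close> by (auto simp: rel_polys_def)
    have "u \<noteq> v"
      using rel_less\<^sub>2 [OF uv(1)] wf_less\<^sub>2 by auto
    then have "Poly_Mapping.lookup f u = 1"
      by (simp add: uv of_word_def lookup_minus lookup_single)
    then have "monic less\<^sub>2 f"
      using lead [OF uv(1)] by (auto simp: monic_def uv(2))
    moreover obtain c d l r where "u = (c, l, d)" "v = (c, r, d)" "Y_path c l d" "Y_path c r d"
      using parallel_S\<^sub>C [OF uv(1)] by (auto simp: parallel_def)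
    then have "f \<in> polys_from_to Y d c"
      by (auto simp: uv polys_from_to_def keys_of_word_diff words_from_to_Y)
    then have "f \<in> polys Y"
      by (auto simp: polys_def Y_def)
    ultimately show ?thesis by blast
  qed
  have context_rel: "(a \<cdot> u \<cdot> b, a \<cdot> v \<cdot> b) \<in> congruence Y S"
    "(a \<cdot> v \<cdot> b, a \<cdot> u \<cdot> b) \<in> less\<^sub>2" "parallel (a \<cdot> v \<cdot> b) (a \<cdot> u \<cdot> b)"
    if uv: "(u, v) \<in> S\<^sub>C" and ab: "a \<in> words Y" "b \<in> words Y" "composable a u" "composable u b"
    for a b u v
  proof -
    obtain m n l r where p: "u = (m, l, n)" "v = (m, r, n)" "Y_path m l n" "Y_path m r n"
      using parallel_S\<^sub>C [OF uv] by (auto simp: parallel_def)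
    obtain c as d bs where q: "a = (c, as, m)" "b = (n, bs, d)" "Y_path c as m" "Y_path n bs d"
      using ab by (cases a, cases b)
        (auto simp: p composable_def words_Y word_cod_def word_dom_def)
    show *: "(a \<cdot> u \<cdot> b, a \<cdot> v \<cdot> b) \<in> congruence Y S"
      using congruence_context [OF _ q(3,4), of l r S] uv S\<^sub>C_congruence by (auto simp: p q)
    show "(a \<cdot> v \<cdot> b, a \<cdot> u \<cdot> b) \<in> less\<^sub>2"
      using less\<^sub>2_prepend [OF less\<^sub>2_append [OF _ q(4)] q(3)] rel_less\<^sub>2 [OF uv] by (simp add: p q)
    show "parallel (a \<cdot> v \<cdot> b) (a \<cdot> u \<cdot> b)"
      using congruence.sym [OF *] by (rule parallel_congruence_S)
  qed
  have inclusion: "trivial_modulo Y less\<^sub>2 ?T (lead_word less\<^sub>2 f) (f - of_word a \<odot> g \<odot> of_word b)"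
    if f: "f \<in> ?T" and g: "g \<in> ?T" and a: "a \<in> words Y" and b: "b \<in> words Y"
      and ab: "composable a (lead_word less\<^sub>2 g)" "composable (lead_word less\<^sub>2 g) b"
      and eq: "lead_word less\<^sub>2 f = a \<cdot> lead_word less\<^sub>2 g \<cdot> b" for f g a b
  proof -
    obtain u v where uv: "(u, v) \<in> S\<^sub>C" "f = of_word u - of_word v"
      using f by (auto simp: rel_polys_def)
    obtain u' v' where uv': "(u', v') \<in> S\<^sub>C" "g = of_word u' - of_word v'"
      using g by (auto simp: rel_polys_def)
    have u: "u = a \<cdot> u' \<cdot> b"
      using eq by (simp add: uv uv' lead)
    note * = context_rel [OF uv'(1) a b, folded u]
    have ab': "composable a u'" "composable u' b"
      using ab by (simp_all add: uv' lead)
    \<comment> \<open>Since u = au'b, the leading terms cancel and the composition is av'b - v, a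
      difference of two congruent words below u.\<close>
    have "(a \<cdot> v' \<cdot> b, v) \<in> congruence Y S"
      using *(1) [OF ab'] uv(1) S\<^sub>C_congruence by (meson congruence.sym congruence.trans subsetD)
    then have "trivial_modulo Y less\<^sub>2 ?T u (of_word (a \<cdot> v' \<cdot> b) - of_word v)"
      using *(2,3) [OF ab'] rel_less\<^sub>2 [OF uv(1)] by (intro congruent_trivial_modulo)
    then show ?thesis
      by (simp add: uv(2) uv'(2) lead [OF uv(1)] of_word_mult_diff diff_mult_of_word
          word_comp_assoc u [symmetric])
  qed
  have intersection:
    "trivial_modulo Y less\<^sub>2 ?T (lead_word less\<^sub>2 f \<cdot> b) (f \<odot> of_word b - of_word a \<odot> g)"
    if f: "f \<in> ?T" and g: "g \<in> ?T" and a: "a \<in> words Y" and b: "b \<in> words Y"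
      and ab: "composable (lead_word less\<^sub>2 f) b" "composable a (lead_word less\<^sub>2 g)"
      and eq: "lead_word less\<^sub>2 f \<cdot> b = a \<cdot> lead_word less\<^sub>2 g" for f g a b
  proof -
    obtain u v where uv: "(u, v) \<in> S\<^sub>C" "f = of_word u - of_word v"
      using f by (auto simp: rel_polys_def)
    obtain u' v' where uv': "(u', v') \<in> S\<^sub>C" "g = of_word u' - of_word v'"
      using g by (auto simp: rel_polys_def)
    have w: "u \<cdot> b = a \<cdot> u'" and ub: "composable u b" and au: "composable a u'"
      using eq ab by (simp_all add: uv uv' lead)
    \<comment> \<open>\<open>context_rel\<close> expects a factor on either side; in an overlap one
      of the two is the empty word at an endpoint of the relation.\<close>
    have unit: "(word_cod x, [], word_cod x) \<in> words Y"
      "composable (word_cod x, [], word_cod x) x" "(word_cod x, [], word_cod x) \<cdot> x \<cdot> y = x \<cdot> y"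
      "(word_dom x, [], word_dom x) \<in> words Y"
      "composable x (word_dom x, [], word_dom x)" "x \<cdot> (word_dom x, [], word_dom x) = x"
      for x y :: Y_word
      by (cases x; simp add: words_Y composable_def word_comp_def word_cod_def word_dom_def)+
    have cod: "word_cod v = word_cod u" "word_dom v' = word_dom u'"
      using parallel_S\<^sub>C [OF uv(1)] parallel_S\<^sub>C [OF uv'(1)]
      by (auto simp: parallel_def word_cod_def word_dom_def)
    have 1: "(u \<cdot> b, v \<cdot> b) \<in> congruence Y S" "(v \<cdot> b, u \<cdot> b) \<in> less\<^sub>2"
      using context_rel [OF uv(1) unit(1) b unit(2) ub] unit(3) [of v b] by (simp_all add: cod unit)
    have 2: "(a \<cdot> u', a \<cdot> v') \<in> congruence Y S" "(a \<cdot> v', a \<cdot> u') \<in> less\<^sub>2"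
      "parallel (a \<cdot> v') (a \<cdot> u')"
      using context_rel [OF uv'(1) a unit(4) au unit(5)] unit(6) [of v'] by (simp_all add: cod unit)
    \<comment> \<open>The common word ub = au' cancels and leaves av' - vb.\<close>
    have "(a \<cdot> v', v \<cdot> b) \<in> congruence Y S"
      using 1 2 w by (metis congruence.sym congruence.trans)
    then have "trivial_modulo Y less\<^sub>2 ?T (u \<cdot> b) (of_word (a \<cdot> v') - of_word (v \<cdot> b))"
      using 1 2 by (intro congruent_trivial_modulo) (simp_all add: w)
    then show ?thesis
      using w by (simp add: uv uv' lead of_word_mult_diff diff_mult_of_word)
  qed
  show ?thesis
    unfolding gs_basis_def using poly inclusion intersection by blast
qed

section \<open>The normal word of a morphism in the quotient category\<close>

lemma equiv_congruence: "equiv (words Y) (congruence Y S)"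
proof (rule equivI)
  show "congruence Y S \<subseteq> words Y \<times> words Y"
    using parallel_congruence_S
    by (fastforce simp: parallel_def words_Y word_cod_def word_dom_def)
qed (auto simp: refl_on_def intro: congruence.refl symI congruence.sym
    intro!: transI elim: congruence.trans)

theorem theorem5p4:
  shows "(gs_basis Y less\<^sub>2 (rel_polys S\<^sub>C :: (Y_word \<Rightarrow>\<^sub>0 'k::field) set) \<and>
          poly_ideal Y (rel_polys S\<^sub>C :: (Y_word \<Rightarrow>\<^sub>0 'k) set) = poly_ideal Y (rel_polys S)) \<and>
         (\<forall>q p. \<forall>\<mu> \<in> quotient_hom Y S q p.
            \<exists>!(is, js, k). normal_indices p q is js k \<and>
              \<mu> = congruence Y S `` {normal_word p q is js k})"
proof (intro conjI allI ballI)
  show "gs_basis Y less\<^sub>2 (rel_polys S\<^sub>C :: (Y_word \<Rightarrow>\<^sub>0 'k) set)"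
    by (rule gs_basis_S\<^sub>C)
  show "poly_ideal Y (rel_polys S\<^sub>C :: (Y_word \<Rightarrow>\<^sub>0 'k) set) = poly_ideal Y (rel_polys S)"
    by (rule poly_ideal_S\<^sub>C)
next
  fix q p \<mu>
  assume "\<mu> \<in> quotient_hom Y S q p"
  then obtain x where x: "x \<in> words_from_to Y q p" and \<mu>: "\<mu> = congruence Y S `` {x}"
    by (auto simp: quotient_hom_def elim: quotientE)
  then obtain es where es: "x = (p, es, q)" "Y_path p es q"
    by (auto simp: words_from_to_Y)
  then have xx: "(x, x) \<in> congruence Y S"
    by (auto intro!: congruence.refl simp: words_Y word_cod_def word_dom_def)
  obtain "is" js k where n: "normal_indices p q is js k"
    "(x, normal_word p q is js k) \<in> congruence Y S"
    using es by (elim normal_form [where 'k = 'k]) auto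
  show "\<exists>!(is, js, k). normal_indices p q is js k \<and>
      \<mu> = congruence Y S `` {normal_word p q is js k}"
  proof (rule ex1I [of _ "(is, js, k)"])
    show "case (is, js, k) of (is, js, k) \<Rightarrow> normal_indices p q is js k \<and>
        \<mu> = congruence Y S `` {normal_word p q is js k}"
      using n equiv_class_eq [OF equiv_congruence n(2)] \<mu> by simp
  next
    fix z
    assume z: "case z of (is, js, k) \<Rightarrow> normal_indices p q is js k \<and>
        \<mu> = congruence Y S `` {normal_word p q is js k}"
    obtain is' js' k' where z_eq: "z = (is', js', k')"
      by (cases z)
    have n': "normal_indices p q is' js' k'"
      "\<mu> = congruence Y S `` {normal_word p q is' js' k'}"
      using z by (simp_all add: z_eq)
    \<comment> \<open>x lies in its own class, which is also the class of the competing normal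
      word.\<close>
    have "(normal_word p q is' js' k', x) \<in> congruence Y S"
      using xx n'(2) \<mu> by blast
    then have "(normal_word p q is' js' k', normal_word p q is js k) \<in> congruence Y S"
      using n(2) by (rule congruence.trans)
    then show "z = (is, js, k)"
      unfolding z_eq by (rule normal_word_unique [OF n'(1) n(1)])
  qed
qed

end
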